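(* Let $\beta>1/2$ with $\beta\notin\mathbf{N}$, and let $a:\mathbf{T}\to\mathbf{C}\setminus\{0\}$ be a function in $C^\beta$ on the complex unit circle $\mathbf{T}$ whose winding number about the origin is zero. Let $a=a_-a_+$ be the Wiener-Hopf factorization given by $$a_-(t)=\exp\sum_{k=1}^\infty(\log a)_{-k}t^{-k},\qquad a_+(t)=\exp\sum_{k=0}^\infty(\log a)_k t^k\qquad(t\in\mathbf{T}),$$ and put $b=a_-a_+^{-1}$, $c=a_+a_-^{-1}$. Let $n\ge 1$ and $\kappa>0$ be integers. If the Toeplitz matrix $T_{n+\kappa}(a)$ is invertible, then the two operators $$I-H(b)H(\tilde c)Q_{n+\kappa}\quad\text{and}\quad I-H(b)Q_nH(\tilde c)Q_\kappa$$ are invertible on $\ell^2(\mathbf{N})$, and $$D_n(t^{-\kappa}a)=(-1)^{n\kappa}D_{n+\kappa}(a)\,F_{n,\kappa}(a),$$ where $$F_{n,\kappa}(a)=\det P_\kappa T(t^{-n})\Big(I-H(b)H(\tilde c)Q_{n+\kappa}\Big)^{-1}T(b)P_\kappa=\det P_\kappa\Big(I-H(b)Q_nH(\tilde c)Q_\kappa\Big)^{-1}T(t^{-n}b)P_\kappa .$$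
   Context: $\mathbf{T}$ is the complex unit circle and $\mathbf{N}=\{1,2,\ldots\}$. $C^\beta$ (for $\beta>0$, $\beta\notin\mathbf{N}$) is the set of functions on $\mathbf{T}$ that have $[\beta]$ continuous derivatives and whose $[\beta]$th derivative satisfies a Hölder condition with exponent $\beta-[\beta]$, where $[\beta]$ is the integer part of $\beta$. For a continuous function $\varphi$ on $\mathbf{T}$, the Fourier coefficients are $\varphi_k=\frac{1}{2\pi}\int_0^{2\pi}\varphi(e^{i\theta})e^{-ik\theta}\,d\theta$, $k\in\mathbf{Z}$. Since $a\in C^\beta$ has no zeros and winding number zero, it has a logarithm $\log a\in C^\beta$; fix one such logarithm and let $(\log a)_k$ denote its Fourier coefficients. The functions $a_\pm^{\pm1}$, $b$, $c$ belong to $C^\beta$, and $a=a_-a_+$, $bc=1$. Finite Toeplitz matrices and determinants: $T_n(\varphi)=(\varphi_{j-k})_{j,k=1}^n$ and $D_n(\varphi)=\det T_n(\varphi)$. The notation $t^{m}\varphi$ ($m\in\mathbf{Z}$) means the function $t\mapsto t^m\varphi(t)$ on $\mathbf{T}$, and $t^m$ alone means the function $t\mapsto t^m$. Infinite Toeplitz and Hankel matrices: $T(\varphi)=(\varphi_{j-k})_{j,k=1}^\infty$ and $H(\varphi)=(\varphi_{j+k-1})_{j,k=1}^\infty$, regarded as bounded linear operators on $\ell^2(\mathbf{N})$. The function $\tilde\varphi$ is defined by $\tilde\varphi(t)=\varphi(1/t)$, so $H(\tilde\varphi)=(\varphi_{-j-k+1})_{j,k=1}^\infty$. For $k\ge1$,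 $P_k$ and $Q_k$ are the projections on $\ell^2(\mathbf{N})$ given by $P_k(x_1,x_2,\ldots)=(x_1,\ldots,x_k,0,0,\ldots)$ and $Q_k(x_1,x_2,\ldots)=(0,\ldots,0,x_{k+1},x_{k+2},\ldots)$, i.e. $Q_k=I-P_k$. An expression $\det P_\kappa A P_\kappa$ for a bounded operator $A$ on $\ell^2(\mathbf{N})$ means the determinant of the $\kappa\times\kappa$ upper-left corner of the matrix of $A$ (the compression of $A$ to the range of $P_\kappa$). *)

theory Defs
  imports
    "HOL-Complex_Analysis.Winding_Numbers"
    "Jordan_Normal_Form.Determinant"
begin

(* A function on the unit circle T is a complex function of which only the values
   on sphere 0 1 matter.

   Derivatives of a function on T are taken with respect to the angle theta,
   t = exp(i theta). The sequence D lists the successive derivatives, again as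
   functions on T. For beta < 1 (no derivatives) the condition is the Hoelder condition
   on f itself. *)
definition holder_class :: "real \<Rightarrow> (complex \<Rightarrow> complex) set" where
  "holder_class \<beta> = {f. \<exists>D :: nat \<Rightarrow> complex \<Rightarrow> complex.
     D 0 = f \<and>
     (\<forall>m < nat \<lfloor>\<beta>\<rfloor>. \<forall>\<theta>::real.
        ((\<lambda>x. D m (cis x)) has_vector_derivative D (Suc m) (cis \<theta>)) (at \<theta>)) \<and>
     (\<forall>m \<le> nat \<lfloor>\<beta>\<rfloor>. continuous_on (sphere 0 1) (D m)) \<and>
     (\<exists>C. \<forall>s\<in>sphere 0 1. \<forall>t\<in>sphere 0 1.
        dist (D (nat \<lfloor>\<beta>\<rfloor>) s) (D (nat \<lfloor>\<beta>\<rfloor>) t) \<le> C * dist s t powr (\<beta> - of_int \<lfloor>\<beta>\<rfloor>))}"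

definition fourier_coeff :: "(complex \<Rightarrow> complex) \<Rightarrow> int \<Rightarrow> complex" where
  "fourier_coeff \<phi> k =
     1 / (2 * complex_of_real pi) *
       integral {0..2 * pi} (\<lambda>\<theta>. \<phi> (cis \<theta>) * exp (- (\<i> * of_int k * complex_of_real \<theta>)))"

(* The Wiener-Hopf factors of a, given a logarithm la of a. *)
definition wh_minus :: "(complex \<Rightarrow> complex) \<Rightarrow> complex \<Rightarrow> complex" where
  "wh_minus la t = exp (\<Sum>k. fourier_coeff la (- int (Suc k)) * t powi (- int (Suc k)))"

definition wh_plus :: "(complex \<Rightarrow> complex) \<Rightarrow> complex \<Rightarrow> complex" where
  "wh_plus la t = exp (\<Sum>k. fourier_coeff la (int k) * t ^ k)"

definition tilde :: "(complex \<Rightarrow> complex) \<Rightarrow> complex \<Rightarrow> complex" where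
  "tilde \<phi> t = \<phi> (1 / t)"

(* Rows, columns and sequence entries are indexed from 0 here instead of from 1: Toeplitz
   entries remain phi_(j-k), while the Hankel entry phi_(j+k-1) becomes phi_(j+k+1). *)

definition toeplitz_mat :: "nat \<Rightarrow> (complex \<Rightarrow> complex) \<Rightarrow> complex mat" where
  "toeplitz_mat n \<phi> = Matrix.mat n n (\<lambda>(j, k). fourier_coeff \<phi> (int j - int k))"

definition toeplitz_det :: "nat \<Rightarrow> (complex \<Rightarrow> complex) \<Rightarrow> complex" where
  "toeplitz_det n \<phi> = Determinant.det (toeplitz_mat n \<phi>)"

type_synonym cseq = "nat \<Rightarrow> complex"

definition l2 :: "cseq set" where
  "l2 = {x. summable (\<lambda>j. (cmod (x j))\<^sup>2)}"

definition l2_norm :: "cseq \<Rightarrow> real" where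
  "l2_norm x = sqrt (\<Sum>j. (cmod (x j))\<^sup>2)"

definition bounded_op :: "(cseq \<Rightarrow> cseq) \<Rightarrow> bool" where
  "bounded_op A \<longleftrightarrow>
     (\<forall>x\<in>l2. A x \<in> l2) \<and>
     (\<forall>x\<in>l2. \<forall>y\<in>l2. A (\<lambda>j. x j + y j) = (\<lambda>j. A x j + A y j)) \<and>
     (\<forall>z. \<forall>x\<in>l2. A (\<lambda>j. z * x j) = (\<lambda>j. z * A x j)) \<and>
     (\<exists>K. \<forall>x\<in>l2. l2_norm (A x) \<le> K * l2_norm x)"

definition invertible_op :: "(cseq \<Rightarrow> cseq) \<Rightarrow> bool" where
  "invertible_op A \<longleftrightarrow> bounded_op A \<and>
     (\<exists>B. bounded_op B \<and> (\<forall>x\<in>l2. A (B x) = x \<and> B (A x) = x))"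

(* Meaningful for operators that are invertible on l2, applied to elements of l2. *)
definition inverse_op :: "(cseq \<Rightarrow> cseq) \<Rightarrow> cseq \<Rightarrow> cseq" where
  "inverse_op A = inv_into l2 A"

(* For continuous phi and x in l2 the series defining the next two operators converge
   absolutely, by Cauchy-Schwarz. *)
definition toeplitz_op :: "(complex \<Rightarrow> complex) \<Rightarrow> cseq \<Rightarrow> cseq" where
  "toeplitz_op \<phi> x = (\<lambda>j. \<Sum>k. fourier_coeff \<phi> (int j - int k) * x k)"

definition hankel_op :: "(complex \<Rightarrow> complex) \<Rightarrow> cseq \<Rightarrow> cseq" where
  "hankel_op \<phi> x = (\<lambda>j. \<Sum>k. fourier_coeff \<phi> (int j + int k + 1) * x k)"

definition id_minus :: "(cseq \<Rightarrow> cseq) \<Rightarrow> cseq \<Rightarrow> cseq" where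
  "id_minus A x = (\<lambda>j. x j - A x j)"

definition proj_P :: "nat \<Rightarrow> cseq \<Rightarrow> cseq" where
  "proj_P k x = (\<lambda>j. if j < k then x j else 0)"

definition proj_Q :: "nat \<Rightarrow> cseq \<Rightarrow> cseq" where
  "proj_Q k = id_minus (proj_P k)"

(* det P_k A P_k: the determinant of the upper-left k x k corner of the matrix of A in the
   standard basis of l2. *)
definition corner_det :: "nat \<Rightarrow> (cseq \<Rightarrow> cseq) \<Rightarrow> complex" where
  "corner_det k A =
     Determinant.det (Matrix.mat k k (\<lambda>(i, j). A (\<lambda>l. if l = j then 1 else 0) i))"

end

theory Submission
  imports Defs
begin

text \<open>
  A Hoelder function of exponent above 1/2 has an absolutely convergent Fourier series
  (Bernstein), so all symbols lie in the Wiener algebra and $T(fg) = T(f)T(g) + H(f)H(\tilde g)$ holds.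
  Write $N = n + \kappa$, $P = P_N$, $Q = Q_N$ and $A = I - H(b)H(\tilde c)Q = P + T(b)T(c)Q$.
  Multiplying by the invertible operator $J = T(a)T(a_-^{-1})$ gives
  $JA = (T(a)P + Q)(T(a_-^{-1})P + T(a_+)Q)$, where the second factor is invertible by triangularity
  and the first one because $T_N(a)$ is. Reading off the first $N$ rows,
  $P A^{-1} T(b) = T(a_-)\,T_N(a)^{-1}\,P\,T(a_-)$, so $F$ is a corner minor of $T_N(a)^{-1}$
  (the unitriangular factors have determinant 1), which Jacobi's identity turns into the
  quotient of Toeplitz determinants. With the shifts $L = T(t^{-n})$ and $R = T(t^n)$ the second
  operator is $B = I - L\,H(b)H(\tilde c)Q_N\,R$, whence $BL = LA$ and
  $B^{-1} = I + L A^{-1} H(b)H(\tilde c) Q_N R$.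
\<close>

section \<open>Fourier coefficients on the circle\<close>

text \<open>The choice of J is forced by the factorization. Here T(b) = T(a_-)T(a_+^{-1}), T(c) =
  T(a_-^{-1})T(a_+) and J = T(a_-)T(a_+)T(a_-^{-1}), hence J T(b) = T(a_-) and J T(b)T(c) = T(a_+).
  So J A = T(a)T(a_-^{-1})P + T(a_+)Q. Now T(a_-^{-1}) is upper triangular and keeps the range of P,
  while T(a_+) is lower triangular and keeps the range of Q; a block diagonal factor therefore
  splits off on the right and leaves T(a)P + Q, whose inversion is a finite problem for T_N(a). The
  exponent of a_- starts at k = 1, so (a_-)_0 = 1. As only a_- survives in P A^{-1} T(b), the
  triangular factors have determinant exactly 1 and no constant enters the final formula. On the
  analytic side, absolute summability over the integers makes every interchange of sums an instance
  of Fubini, and it bounds all Toeplitz and Hankel matrices by their row and column sums.\<close>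

lemma cis_powi: "cis \<theta> powi k = cis (of_int k * \<theta>)"
  by (cases "k \<ge> 0") (auto simp: power_int_def Complex.DeMoivre)

lemma fourier_coeff_cis:
  "fourier_coeff f k = 1 / (2 * complex_of_real pi) * integral {0..2 * pi} (\<lambda>\<theta>. f (cis \<theta>) * cis \<theta> powi (- k))"
proof -
  have "exp (- (\<i> * of_int k * complex_of_real \<theta>)) = cis \<theta> powi (- k)" for \<theta>
    unfolding cis_powi unfolding cis_conv_exp by (simp add: mult_ac)
  then show ?thesis by (simp add: fourier_coeff_def)
qed

lemma fourier_coeff_cong:
  assumes "\<And>t. t \<in> sphere 0 1 \<Longrightarrow> f t = g t"
  shows "fourier_coeff f = fourier_coeff g"
  using assms by (intro ext) (simp add: fourier_coeff_cis)

lemma continuous_on_cis_compose: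
  assumes "continuous_on (sphere 0 1) f"
  shows "continuous_on S (\<lambda>\<theta>. f (cis \<theta>))"
  by (rule continuous_on_compose2[OF assms]) (auto intro!: continuous_intros)

lemma fourier_integrand_continuous:
  assumes "continuous_on (sphere 0 1) f"
  shows "continuous_on S (\<lambda>\<theta>. f (cis \<theta>) * cis \<theta> powi k)"
  unfolding cis_powi
  by (intro continuous_intros continuous_on_cis_compose assms)

lemma fourier_coeff_add:
  assumes "continuous_on (sphere 0 1) f" "continuous_on (sphere 0 1) g"
  shows "fourier_coeff (\<lambda>t. f t + g t) k = fourier_coeff f k + fourier_coeff g k"
  unfolding fourier_coeff_cis distrib_right
  by (subst Henstock_Kurzweil_Integration.integral_add)
    (auto intro!: integrable_continuous_interval fourier_integrand_continuous assms simp: distrib_left)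

lemma fourier_coeff_cmult: "fourier_coeff (\<lambda>t. c * f t) k = c * fourier_coeff f k"
  unfolding fourier_coeff_cis by (simp add: mult.assoc)

lemma fourier_coeff_diff:
  assumes "continuous_on (sphere 0 1) f" "continuous_on (sphere 0 1) g"
  shows "fourier_coeff (\<lambda>t. f t - g t) k = fourier_coeff f k - fourier_coeff g k"
  using fourier_coeff_add[OF assms(1) continuous_on_mult[OF continuous_on_const assms(2)], of "-1" k]
    fourier_coeff_cmult[of "-1" g k]
  by simp

lemma fourier_coeff_sum:
  assumes "finite F" "\<And>i. i \<in> F \<Longrightarrow> continuous_on (sphere 0 1) (f i)"
  shows "fourier_coeff (\<lambda>t. \<Sum>i\<in>F. f i t) k = (\<Sum>i\<in>F. fourier_coeff (f i) k)"
  using assms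
proof (induction F rule: finite_induct)
  case empty
  then show ?case by (simp add: fourier_coeff_cis)
next
  case (insert i F)
  then show ?case
    by (simp add: fourier_coeff_add continuous_on_sum)
qed

lemma norm_fourier_coeff_le:
  assumes "continuous_on (sphere 0 1) f" "\<And>t. t \<in> sphere 0 1 \<Longrightarrow> norm (f t) \<le> B"
  shows "norm (fourier_coeff f k) \<le> B"
proof -
  have "norm (integral {0..2 * pi} (\<lambda>\<theta>. f (cis \<theta>) * cis \<theta> powi (- k))) \<le> B * (2 * pi - 0)"
    by (rule integral_bound) (use assms(2) in \<open>auto intro!: fourier_integrand_continuous assms(1)
      simp: norm_mult norm_power_int\<close>)
  then show ?thesis
    by (simp add: fourier_coeff_cis norm_mult norm_divide field_simps)
qed

lemma fourier_coeff_powi_mult: "fourier_coeff (\<lambda>t. t powi m * f t) k = fourier_coeff f (k - m)"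
proof -
  have "cis \<theta> powi (- (k - m)) = cis \<theta> powi m * cis \<theta> powi (- k)" for \<theta>
    by (simp add: cis_powi cis_mult algebra_simps)
  then show ?thesis by (simp add: fourier_coeff_cis mult_ac)
qed

lemma fourier_coeff_one: "fourier_coeff (\<lambda>t. 1) k = (if k = 0 then 1 else 0)"
proof (cases "k = 0")
  case True
  then show ?thesis by (simp add: fourier_coeff_cis scaleR_conv_of_real)
next
  case False
  let ?F = "\<lambda>\<theta>::real. cis (of_int (- k) * \<theta>) / (- \<i> * of_int k)"
  have "((\<lambda>\<theta>. cis \<theta> powi (- k)) has_integral (?F (2 * pi) - ?F 0)) {0..2 * pi}"
  proof (rule fundamental_theorem_of_calculus)
    fix x :: real
    have "((\<lambda>\<theta>. exp (\<i> * (of_int (- k) * complex_of_real \<theta>)) / (- \<i> * of_int k)) has_vector_derivative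
        exp (\<i> * (of_int (- k) * complex_of_real x))) (at x within {0..2 * pi})"
      using False by (auto intro!: derivative_eq_intros has_vector_derivative_real_field simp: field_simps)
    then show "(?F has_vector_derivative cis x powi (- k)) (at x within {0..2 * pi})"
      unfolding cis_powi unfolding cis_conv_exp by simp
  qed simp
  moreover have "?F (2 * pi) = ?F 0"
    using cis_multiple_2pi[of "of_int (-k)"] by (simp add: mult_ac)
  ultimately show ?thesis
    using False by (simp add: fourier_coeff_cis has_integral_iff)
qed

lemma fourier_coeff_const: "fourier_coeff (\<lambda>t. c) k = (if k = 0 then c else 0)"
  using fourier_coeff_cmult[of c "\<lambda>t. 1" k] by (simp add: fourier_coeff_one)

lemma fourier_coeff_powi: "fourier_coeff (\<lambda>t. t powi m) k = (if k = m then 1 else 0)"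
  using fourier_coeff_powi_mult[of m "\<lambda>_. 1" k] by (simp add: fourier_coeff_one)

text \<open>Integrals over a full period are translation invariant: the shifted interval is cut at 2
  pi and the overhang is moved back by periodicity. A rotation thus acts on coefficients as a
  multiplier, which the estimate of dyadic blocks exploits.\<close>

lemma fourier_coeff_rotate:
  assumes f: "continuous_on (sphere 0 1) f" and h: "0 \<le> h" "h \<le> 2 * pi"
  shows "fourier_coeff (\<lambda>t. f (cis h * t)) k = cis h powi k * fourier_coeff f k"
proof -
  define G where "G = (\<lambda>\<theta>. f (cis \<theta>) * cis \<theta> powi (- k))"
  have G: "G integrable_on {x..y}" for x y
    unfolding G_def by (intro integrable_continuous_interval fourier_integrand_continuous f)
  have periodic: "G (\<theta> + 2 * pi) = G \<theta>" for \<theta>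
    by (simp add: G_def cis_mult flip: cis_mult)
  have "integral {0..2 * pi} (\<lambda>\<theta>. G (\<theta> + h)) = integral {h..2 * pi + h} G"
    using integral_shift_real_ivl[of h h "2 * pi + h" G] by simp
  also have "\<dots> = integral {h..2 * pi} G + integral {2 * pi..2 * pi + h} G"
    using h by (intro Henstock_Kurzweil_Integration.integral_combine[symmetric] G) auto
  also have "integral {2 * pi..2 * pi + h} G = integral {0..h} G"
    using integral_shift_real_ivl[of "2 * pi" "2 * pi" "2 * pi + h" G] by (simp add: periodic)
  also have "integral {h..2 * pi} G + integral {0..h} G = integral {0..2 * pi} G"
    using Henstock_Kurzweil_Integration.integral_combine[of 0 h "2 * pi" G] h G by (simp add: add.commute)
  finally have "integral {0..2 * pi} (\<lambda>\<theta>. G (\<theta> + h)) = integral {0..2 * pi} G" .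
  moreover have "f (cis h * cis \<theta>) * cis \<theta> powi (- k) = cis h powi k * G (\<theta> + h)" for \<theta>
    by (simp add: G_def cis_powi cis_mult algebra_simps)
  ultimately show ?thesis
    by (simp add: fourier_coeff_cis G_def)
qed

lemma fourier_coeff_Re_nonneg:
  assumes "continuous_on (sphere 0 1) f" "\<And>t. t \<in> sphere 0 1 \<Longrightarrow> 0 \<le> Re (f t)"
  shows "0 \<le> Re (fourier_coeff f 0)"
proof -
  have "(\<lambda>\<theta>. f (cis \<theta>)) integrable_on {0..2 * pi}"
    by (intro integrable_continuous_interval continuous_on_cis_compose assms)
  then have "Re (integral {0..2 * pi} (\<lambda>\<theta>. f (cis \<theta>))) = integral {0..2 * pi} (\<lambda>\<theta>. Re (f (cis \<theta>)))"
    by (rule integral_linear[OF _ bounded_linear_Re, unfolded o_def, symmetric])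
  also have "\<dots> \<ge> 0"
    by (rule Henstock_Kurzweil_Integration.integral_nonneg)
      (auto intro!: integrable_continuous_interval continuous_intros continuous_on_cis_compose assms)
  finally show ?thesis
    by (simp add: fourier_coeff_cis Re_divide_of_real flip: of_real_mult)
qed

text \<open>With \<open>s\<close> the partial Fourier sum over \<open>F\<close>, the mean of the
  squared modulus of \<open>f - s\<close> is nonnegative. Expanding it and bounding the squared
  modulus of \<open>f\<close> by the square of \<open>B\<close> gives the claim.\<close>

lemma bessel:
  assumes f: "continuous_on (sphere 0 1) f" and B: "\<And>t. t \<in> sphere 0 1 \<Longrightarrow> norm (f t) \<le> B"
    and F: "finite F"
  shows "(\<Sum>k\<in>F. (norm (fourier_coeff f k))\<^sup>2) \<le> B\<^sup>2"
proof -
  define s where "s t = (\<Sum>k\<in>F. fourier_coeff f k * t powi k)" for t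
  \<comment> \<open>On the circle this is the conjugate of \<open>s\<close>, written as a Laurent
    polynomial so that multiplying by it only shifts coefficients.\<close>
  define s' where "s' t = (\<Sum>k\<in>F. cnj (fourier_coeff f k) * t powi (- k))" for t
  have s: "continuous_on (sphere 0 1) s" and s': "continuous_on (sphere 0 1) s'"
    unfolding s_def s'_def by (auto intro!: continuous_intros)
  have cnj_s: "cnj (s t) = s' t" if "t \<in> sphere 0 1" for t
  proof -
    have "t * cnj t = 1"
      using that by (simp flip: complex_norm_square)
    then have "cnj t = inverse t"
      by (rule inverse_unique[symmetric])
    then show ?thesis by (simp add: s_def s'_def power_int_minus power_int_inverse)
  qed
  have mean: "fourier_coeff (\<lambda>t. g t * s' t) 0 = (\<Sum>k\<in>F. cnj (fourier_coeff f k) * fourier_coeff g k)"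
    if "continuous_on (sphere 0 1) g" for g
  proof -
    have "(\<lambda>t. g t * s' t) = (\<lambda>t. \<Sum>k\<in>F. cnj (fourier_coeff f k) * (t powi (- k) * g t))"
      by (simp add: s'_def sum_distrib_left sum_distrib_right mult_ac)
    then show ?thesis
      using that F
      by (simp only:, subst fourier_coeff_sum)
        (auto simp: fourier_coeff_cmult fourier_coeff_powi_mult intro!: continuous_intros)
  qed
  have coeff_s: "fourier_coeff s k = fourier_coeff f k" if "k \<in> F" for k
    unfolding s_def using F that
    by (subst fourier_coeff_sum) (auto simp: fourier_coeff_cmult fourier_coeff_powi if_distrib[of "(*) _"] cong: if_cong
        intro!: continuous_intros)
  have "0 \<le> Re (fourier_coeff (\<lambda>t. of_real (B\<^sup>2) - 2 * (f t * s' t) + s t * s' t) 0)"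
  proof (rule fourier_coeff_Re_nonneg)
    fix t :: complex assume t: "t \<in> sphere 0 1"
    have "0 \<le> (norm (f t - s t))\<^sup>2"
      by simp
    also have "\<dots> = (norm (f t))\<^sup>2 - 2 * Re (f t * cnj (s t)) + (norm (s t))\<^sup>2"
      unfolding cmod_power2 by (simp add: power2_eq_square algebra_simps)
    also have "\<dots> \<le> B\<^sup>2 - 2 * Re (f t * cnj (s t)) + (norm (s t))\<^sup>2"
      using B[OF t] by (simp add: power_mono)
    also have "\<dots> = Re (of_real (B\<^sup>2) - 2 * (f t * s' t) + s t * s' t)"
      by (simp flip: cnj_s[OF t] complex_norm_square)
    finally show "0 \<le> Re (of_real (B\<^sup>2) - 2 * (f t * s' t) + s t * s' t)" .
  qed (intro continuous_intros f s s')
  also have "fourier_coeff (\<lambda>t. of_real (B\<^sup>2) - 2 * (f t * s' t) + s t * s' t) 0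
      = of_real (B\<^sup>2) - 2 * fourier_coeff (\<lambda>t. f t * s' t) 0 + fourier_coeff (\<lambda>t. s t * s' t) 0"
    by (simp only: fourier_coeff_add fourier_coeff_diff fourier_coeff_cmult fourier_coeff_const
        continuous_on_mult continuous_on_diff continuous_on_const f s s' simp_thms if_True)
  \<comment> \<open>By \<open>mean\<close>, both sides depend only on coefficients with index in
    \<open>F\<close>, where \<open>s\<close> and \<open>f\<close> agree: \<open>s\<close> is the
    orthogonal projection of \<open>f\<close>.\<close>
  also have "fourier_coeff (\<lambda>t. s t * s' t) 0 = fourier_coeff (\<lambda>t. f t * s' t) 0"
    by (simp add: mean f s coeff_s)
  also have "fourier_coeff (\<lambda>t. f t * s' t) 0 = of_real (\<Sum>k\<in>F. (norm (fourier_coeff f k))\<^sup>2)"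
    by (simp only: mean[OF f] of_real_sum complex_norm_square mult.commute)
  finally show ?thesis by simp
qed

section \<open>Absolutely convergent Fourier series\<close>

text \<open>The coefficients are a free parameter, so a closure property is proved by exhibiting a
  series; that they must be the Fourier coefficients is shown separately. \<open>has_sum\<close> is
  unconditional convergence, which permits reindexing over the integers.\<close>

definition wiener_series :: "(complex \<Rightarrow> complex) \<Rightarrow> (int \<Rightarrow> complex) \<Rightarrow> bool" where
  "wiener_series f \<phi> \<longleftrightarrow> (\<lambda>k. norm (\<phi> k)) summable_on UNIV \<and>
     (\<forall>t\<in>sphere 0 1. ((\<lambda>k. \<phi> k * t powi k) has_sum f t) UNIV)"

text \<open>The finite set can be enlarged at no cost, so a prescribed index \<open>k\<close> is
  included. The approximating Laurent polynomial then has exactly the coefficient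
  \<open>\<phi> k\<close>, which identifies \<open>\<phi>\<close> with the Fourier coefficients in
  the limit.\<close>

lemma wiener_series_approx:
  assumes f: "wiener_series f \<phi>" and e: "e > 0"
  obtains F where "finite F" "k \<in> F"
    "\<And>t. t \<in> sphere 0 1 \<Longrightarrow> norm (f t - (\<Sum>j\<in>F. \<phi> j * t powi j)) \<le> e"
proof -
  let ?N = "\<lambda>k. norm (\<phi> k)"
  have sum: "?N summable_on UNIV"
    using f by (simp add: wiener_series_def)
  then have "(sum ?N \<longlongrightarrow> infsum ?N UNIV) (finite_subsets_at_top UNIV)"
    by (rule infsum_tendsto)
  then have "\<forall>\<^sub>F F in finite_subsets_at_top UNIV. dist (sum ?N F) (infsum ?N UNIV) < e"
    using e by (rule tendstoD)
  then obtain F0 where F0: "finite F0" "\<And>F. finite F \<Longrightarrow> F0 \<subseteq> F \<Longrightarrow> dist (sum ?N F) (infsum ?N UNIV) < e"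
    unfolding eventually_finite_subsets_at_top by auto
  let ?F = "insert k F0"
  have F: "finite ?F" "dist (sum ?N ?F) (infsum ?N UNIV) < e"
    using F0(1) by (auto intro!: F0(2))
  have tail: "(?N has_sum (infsum ?N UNIV - sum ?N ?F)) (UNIV - ?F)"
    using has_sum_Diff[OF has_sum_infsum[OF sum] has_sum_finite[OF F(1), of ?N]] by simp
  have "norm (f t - (\<Sum>j\<in>?F. \<phi> j * t powi j)) \<le> e" if t: "t \<in> sphere 0 1" for t
  proof -
    have "((\<lambda>k. \<phi> k * t powi k) has_sum f t) UNIV"
      using f t by (simp add: wiener_series_def)
    then have "((\<lambda>k. \<phi> k * t powi k) has_sum (f t - (\<Sum>j\<in>?F. \<phi> j * t powi j))) (UNIV - ?F)"
      using has_sum_Diff[OF _ has_sum_finite[OF F(1)]] by blast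
    then have "norm (f t - (\<Sum>j\<in>?F. \<phi> j * t powi j)) \<le> infsum ?N UNIV - sum ?N ?F"
      using tail by (rule norm_infsum_le) (use t in \<open>simp add: norm_mult norm_power_int\<close>)
    also have "\<dots> \<le> e"
      using F(2) by (simp add: dist_real_def)
    finally show ?thesis .
  qed
  then show thesis
    using that[of ?F] F(1) by blast
qed

lemma wiener_series_continuous:
  assumes "wiener_series f \<phi>"
  shows "continuous_on (sphere 0 1) f"
proof -
  have "\<exists>F. finite F \<and> (\<forall>t\<in>sphere 0 1. norm (f t - (\<Sum>j\<in>F. \<phi> j * t powi j)) \<le> inverse (real (Suc n)))" for n
    using wiener_series_approx[OF assms, of "inverse (real (Suc n))"] by (metis inverse_positive_iff_positive of_nat_0_less_iff zero_less_Suc)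
  then obtain F where F: "\<And>n. finite (F n)"
      "\<And>n t. t \<in> sphere 0 1 \<Longrightarrow> norm (f t - (\<Sum>j\<in>F n. \<phi> j * t powi j)) \<le> inverse (real (Suc n))"
    by metis
  let ?s = "\<lambda>n t. \<Sum>j\<in>F n. \<phi> j * t powi j"
  have "\<forall>\<^sub>F n in sequentially. continuous_on (sphere 0 1) (?s n)"
    by (intro always_eventually allI continuous_intros) auto
  moreover have "uniform_limit (sphere 0 1) ?s f sequentially"
  proof (rule uniform_limitI)
    fix e :: real assume "e > 0"
    with LIMSEQ_inverse_real_of_nat have "\<forall>\<^sub>F n in sequentially. inverse (real (Suc n)) < e"
      by (rule order_tendstoD)
    then show "\<forall>\<^sub>F n in sequentially. \<forall>t\<in>sphere 0 1. dist (?s n t) (f t) < e"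
    proof eventually_elim
      case (elim n)
      show ?case
      proof
        fix t :: complex assume "t \<in> sphere 0 1"
        then have "dist (f t) (?s n t) \<le> inverse (real (Suc n))"
          unfolding dist_norm by (rule F(2))
        with elim show "dist (?s n t) (f t) < e"
          by (simp add: dist_commute)
      qed
    qed
  qed
  ultimately show ?thesis
    by (rule uniform_limit_theorem) simp
qed

lemma wiener_series_fourier_coeff:
  assumes f: "wiener_series f \<phi>"
  shows "fourier_coeff f = \<phi>"
proof
  fix k
  have "norm (fourier_coeff f k - \<phi> k) \<le> e" if "e > 0" for e
  proof -
    obtain F where F: "finite F" "k \<in> F"
        "\<And>t. t \<in> sphere 0 1 \<Longrightarrow> norm (f t - (\<Sum>j\<in>F. \<phi> j * t powi j)) \<le> e"
      using wiener_series_approx[OF f \<open>e > 0\<close>] by metis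
    let ?s = "\<lambda>t. \<Sum>j\<in>F. \<phi> j * t powi j"
    have s: "continuous_on (sphere 0 1) ?s"
      by (auto intro!: continuous_intros)
    have "fourier_coeff ?s k = \<phi> k"
      using F(1,2) by (subst fourier_coeff_sum)
        (auto simp: fourier_coeff_cmult fourier_coeff_powi if_distrib[of "(*) _"] cong: if_cong
        intro!: continuous_intros)
    then have "fourier_coeff f k - \<phi> k = fourier_coeff (\<lambda>t. f t - ?s t) k"
      by (simp add: fourier_coeff_diff wiener_series_continuous[OF f] s)
    also have "norm \<dots> \<le> e"
      by (rule norm_fourier_coeff_le) (use F(3) s wiener_series_continuous[OF f] in \<open>auto intro!: continuous_intros\<close>)
    finally show ?thesis .
  qed
  then have "norm (fourier_coeff f k - \<phi> k) \<le> 0"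
    by (metis field_le_epsilon add_0)
  then show "fourier_coeff f k = \<phi> k" by simp
qed

lemma wiener_series_cong:
  assumes "wiener_series f \<phi>" "\<And>t. t \<in> sphere 0 1 \<Longrightarrow> f t = g t" "\<And>k. \<phi> k = \<psi> k"
  shows "wiener_series g \<psi>"
proof -
  have "\<phi> = \<psi>" using assms(3) by blast
  then show ?thesis using assms(1,2) by (simp add: wiener_series_def)
qed

lemma wiener_series_const: "wiener_series (\<lambda>t. c) (\<lambda>k. if k = 0 then c else 0)"
  unfolding wiener_series_def
  by (auto intro!: has_sum_finite_neutralI[of "{0}"] finite_nonzero_values_imp_summable_on split: if_splits)

lemma wiener_series_cmult:
  assumes "wiener_series f \<phi>"
  shows "wiener_series (\<lambda>t. c * f t) (\<lambda>k. c * \<phi> k)"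
  using assms unfolding wiener_series_def
  by (auto simp: norm_mult mult.assoc intro!: summable_on_cmult_right has_sum_cmult_right)

lemma wiener_series_powi_mult:
  assumes "wiener_series f \<phi>"
  shows "wiener_series (\<lambda>t. t powi m * f t) (\<lambda>k. \<phi> (k - m))"
  unfolding wiener_series_def
proof (intro conjI ballI)
  show "(\<lambda>k. norm (\<phi> (k - m))) summable_on UNIV"
    using assms by (subst summable_on_reindex_bij_witness[of _ "\<lambda>k. k + m" "\<lambda>k. k - m" UNIV "\<lambda>k. norm (\<phi> k)"])
      (auto simp: wiener_series_def)
  fix t :: complex assume t: "t \<in> sphere 0 1"
  then have "t \<noteq> 0" by auto
  have "((\<lambda>k. t powi m * (\<phi> k * t powi k)) has_sum t powi m * f t) UNIV"
    using assms t by (intro has_sum_cmult_right) (auto simp: wiener_series_def)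
  then show "((\<lambda>k. \<phi> (k - m) * t powi k) has_sum t powi m * f t) UNIV"
    using \<open>t \<noteq> 0\<close>
    by (subst has_sum_reindex_bij_witness[of _ "\<lambda>k. k + m" "\<lambda>k. k - m" UNIV "\<lambda>k. t powi m * (\<phi> k * t powi k)"])
      (auto simp: power_int_diff)
qed

lemma wiener_series_tilde:
  assumes "wiener_series f \<phi>"
  shows "wiener_series (tilde f) (\<lambda>k. \<phi> (- k))"
  unfolding wiener_series_def
proof (intro conjI ballI)
  show "(\<lambda>k. norm (\<phi> (- k))) summable_on UNIV"
    using assms by (subst summable_on_reindex_bij_witness[of _ uminus uminus UNIV "\<lambda>k. norm (\<phi> k)"])
      (auto simp: wiener_series_def)
  fix t :: complex assume t: "t \<in> sphere 0 1"
  have "((\<lambda>k. \<phi> k * (1 / t) powi k) has_sum f (1 / t)) UNIV"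
    using assms t unfolding wiener_series_def by (simp add: norm_divide)
  then show "((\<lambda>k. \<phi> (- k) * t powi k) has_sum tilde f t) UNIV"
    by (subst has_sum_reindex_bij_witness[of _ uminus uminus UNIV "\<lambda>k. \<phi> k * (1 / t) powi k"])
      (auto simp: tilde_def power_int_minus power_int_inverse divide_inverse)
qed

lemma wiener_series_restrict:
  assumes "wiener_series f \<phi>"
  shows "wiener_series (\<lambda>t. \<Sum>\<^sub>\<infinity>k\<in>S. \<phi> k * t powi k) (\<lambda>k. if k \<in> S then \<phi> k else 0)"
  unfolding wiener_series_def
proof (intro conjI ballI)
  have abs: "(\<lambda>k. norm (\<phi> k)) summable_on UNIV"
    using assms by (simp add: wiener_series_def)
  then show "(\<lambda>k. norm (if k \<in> S then \<phi> k else 0)) summable_on UNIV"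
    by (rule summable_on_comparison_test) auto
  fix t :: complex assume t: "t \<in> sphere 0 1"
  have "(\<lambda>k. \<phi> k * t powi k) summable_on UNIV"
    using assms t by (auto simp: wiener_series_def intro: has_sum_imp_summable)
  then have "(\<lambda>k. \<phi> k * t powi k) summable_on S"
    by (rule summable_on_subset) auto
  then have "((\<lambda>k. \<phi> k * t powi k) has_sum (\<Sum>\<^sub>\<infinity>k\<in>S. \<phi> k * t powi k)) S"
    by (rule has_sum_infsum)
  then show "((\<lambda>k. (if k \<in> S then \<phi> k else 0) * t powi k) has_sum (\<Sum>\<^sub>\<infinity>k\<in>S. \<phi> k * t powi k)) UNIV"
    by (subst has_sum_cong_neutral[where T = S and g = "\<lambda>k. \<phi> k * t powi k"]) auto
qed

text \<open>Tonelli gives joint summability from the iterated sums of norms; the last claim is the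
  triangle inequality of l1 over the index \<open>k\<close> for infinitely many summands.\<close>

lemma infsum_norm_triangle:
  fixes \<Phi> :: "'i \<Rightarrow> 'k \<Rightarrow> complex"
  assumes \<Phi>: "\<And>i. (\<lambda>k. norm (\<Phi> i k)) summable_on UNIV"
    and sum: "(\<lambda>i. \<Sum>\<^sub>\<infinity>k. norm (\<Phi> i k)) summable_on UNIV"
  shows "(\<lambda>(i, k). norm (\<Phi> i k)) summable_on UNIV \<times> UNIV"
    and "(\<lambda>k. norm (\<Sum>\<^sub>\<infinity>i. \<Phi> i k)) summable_on UNIV"
    and "(\<Sum>\<^sub>\<infinity>k. norm (\<Sum>\<^sub>\<infinity>i. \<Phi> i k)) \<le> (\<Sum>\<^sub>\<infinity>i. \<Sum>\<^sub>\<infinity>k. norm (\<Phi> i k))"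
proof -
  have "(\<lambda>x. norm (case_prod \<Phi> x)) summable_on UNIV \<times> UNIV"
    using Infinite_Sum.abs_summable_on_Sigma_iff[where f = "case_prod \<Phi>" and A = UNIV and B = "\<lambda>_. UNIV"] \<Phi> sum by (simp add: infsum_nonneg)
  then show joint: "(\<lambda>(i, k). norm (\<Phi> i k)) summable_on UNIV \<times> UNIV"
    by (simp add: case_prod_unfold)
  then have "(\<lambda>(k, i). norm (\<Phi> i k)) summable_on UNIV \<times> UNIV"
    by (subst (asm) summable_on_swap) (simp add: case_prod_unfold)
  then have cols: "(\<lambda>k. \<Sum>\<^sub>\<infinity>i. norm (\<Phi> i k)) summable_on UNIV" "(\<lambda>i. norm (\<Phi> i k)) summable_on UNIV" for k
    using summable_on_SigmaD1[of "\<lambda>k i. norm (\<Phi> i k)" UNIV "\<lambda>_. UNIV" k]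
      summable_on_Sigma_banach[of "\<lambda>k i. norm (\<Phi> i k)" UNIV "\<lambda>_. UNIV"] by simp_all
  have le: "norm (\<Sum>\<^sub>\<infinity>i. \<Phi> i k) \<le> (\<Sum>\<^sub>\<infinity>i. norm (\<Phi> i k))" for k
    by (rule norm_infsum_bound) (rule cols)
  show rows: "(\<lambda>k. norm (\<Sum>\<^sub>\<infinity>i. \<Phi> i k)) summable_on UNIV"
    by (rule summable_on_comparison_test[OF cols(1)]) (use le in auto)
  have "(\<Sum>\<^sub>\<infinity>k. norm (\<Sum>\<^sub>\<infinity>i. \<Phi> i k)) \<le> (\<Sum>\<^sub>\<infinity>k. \<Sum>\<^sub>\<infinity>i. norm (\<Phi> i k))"
    by (rule infsum_mono) (use rows cols le in auto)
  also have "\<dots> = (\<Sum>\<^sub>\<infinity>i. \<Sum>\<^sub>\<infinity>k. norm (\<Phi> i k))"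
    by (rule infsum_swap_banach[symmetric]) (rule joint)
  finally show "(\<Sum>\<^sub>\<infinity>k. norm (\<Sum>\<^sub>\<infinity>i. \<Phi> i k)) \<le> (\<Sum>\<^sub>\<infinity>i. \<Sum>\<^sub>\<infinity>k. norm (\<Phi> i k))" .
qed

text \<open>Completeness of the Wiener algebra: a series of elements whose l1 norms are summable
  stays inside, and its coefficients may be summed termwise. Products and exponentials are both
  obtained from it.\<close>

lemma wiener_series_infsum:
  fixes F :: "'i \<Rightarrow> complex \<Rightarrow> complex"
  assumes F: "\<And>i. wiener_series (F i) (\<Phi> i)"
    and sum: "(\<lambda>i. \<Sum>\<^sub>\<infinity>k. norm (\<Phi> i k)) summable_on UNIV"
  shows "wiener_series (\<lambda>t. \<Sum>\<^sub>\<infinity>i. F i t) (\<lambda>k. \<Sum>\<^sub>\<infinity>i. \<Phi> i k)"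
  unfolding wiener_series_def
proof (intro conjI ballI)
  have \<Phi>: "(\<lambda>k. norm (\<Phi> i k)) summable_on UNIV" for i
    using F by (simp add: wiener_series_def)
  show "(\<lambda>k. norm (\<Sum>\<^sub>\<infinity>i. \<Phi> i k)) summable_on UNIV"
    by (rule infsum_norm_triangle[OF \<Phi> sum])
  fix t :: complex assume t: "t \<in> sphere 0 1"
  let ?g = "\<lambda>i k. \<Phi> i k * t powi k"
  have n: "norm (?g i k) = norm (\<Phi> i k)" for i k
    using t by (simp add: norm_mult norm_power_int)
  have "(\<lambda>(i, k). norm (?g i k)) summable_on UNIV \<times> UNIV"
    unfolding n by (rule infsum_norm_triangle[OF \<Phi> sum])
  then have "(\<lambda>x. norm (case x of (i, k) \<Rightarrow> ?g i k)) summable_on UNIV \<times> UNIV"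
    by (simp add: case_prod_unfold)
  then have joint: "(\<lambda>(i, k). ?g i k) summable_on UNIV \<times> UNIV"
    by (rule abs_summable_summable)
  have Ft: "F i t = (\<Sum>\<^sub>\<infinity>k. ?g i k)" for i
    using F[of i] t by (auto simp: wiener_series_def intro!: infsumI[symmetric])
  have eq: "(\<Sum>\<^sub>\<infinity>i. F i t) = (\<Sum>\<^sub>\<infinity>k. \<Sum>\<^sub>\<infinity>i. ?g i k)"
    unfolding Ft by (rule infsum_swap_banach) (rule joint)
  have "(\<lambda>(k, i). ?g i k) summable_on UNIV \<times> UNIV"
    using joint by (subst (asm) summable_on_swap) (simp add: case_prod_unfold)
  then have "(\<lambda>k. \<Sum>\<^sub>\<infinity>i. ?g i k) summable_on UNIV"
    using summable_on_Sigma_banach[of "\<lambda>k i. ?g i k" UNIV "\<lambda>_. UNIV"] by simp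
  then have "((\<lambda>k. \<Sum>\<^sub>\<infinity>i. ?g i k) has_sum (\<Sum>\<^sub>\<infinity>i. F i t)) UNIV"
    unfolding eq by (rule has_sum_infsum)
  moreover have "(\<Sum>\<^sub>\<infinity>i. \<Phi> i k) * t powi k = (\<Sum>\<^sub>\<infinity>i. ?g i k)" for k
    by (rule infsum_cmult_left'[symmetric])
  ultimately show "((\<lambda>k. (\<Sum>\<^sub>\<infinity>i. \<Phi> i k) * t powi k) has_sum (\<Sum>\<^sub>\<infinity>i. F i t)) UNIV"
    by (simp only:)
qed

text \<open>The product is the sum over \<open>j\<close> of the copies of \<open>g\<close> shifted
  by \<open>j\<close> and scaled by \<open>\<phi> j\<close>; a shift preserves the l1 norm, which
  yields submultiplicativity as well.\<close>

lemma wiener_series_mult: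
  assumes f: "wiener_series f \<phi>" and g: "wiener_series g \<psi>"
  shows "wiener_series (\<lambda>t. f t * g t) (\<lambda>k. \<Sum>\<^sub>\<infinity>j. \<phi> j * \<psi> (k - j))"
    and "(\<Sum>\<^sub>\<infinity>k. norm (\<Sum>\<^sub>\<infinity>j. \<phi> j * \<psi> (k - j))) \<le> (\<Sum>\<^sub>\<infinity>k. norm (\<phi> k)) * (\<Sum>\<^sub>\<infinity>k. norm (\<psi> k))"
proof -
  have F: "wiener_series (\<lambda>t. \<phi> j * (t powi j * g t)) (\<lambda>k. \<phi> j * \<psi> (k - j))" for j
    by (intro wiener_series_cmult wiener_series_powi_mult g)
  have "(\<Sum>\<^sub>\<infinity>k. norm (\<psi> (k - j))) = (\<Sum>\<^sub>\<infinity>k. norm (\<psi> k))" for j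
    by (rule infsum_reindex_bij_witness[of _ "\<lambda>k. k + j" "\<lambda>k. k - j"]) auto
  then have N: "(\<Sum>\<^sub>\<infinity>k. norm (\<phi> j * \<psi> (k - j))) = norm (\<phi> j) * (\<Sum>\<^sub>\<infinity>k. norm (\<psi> k))" for j
    by (simp add: norm_mult infsum_cmult_right')
  have sum: "(\<lambda>j. \<Sum>\<^sub>\<infinity>k. norm (\<phi> j * \<psi> (k - j))) summable_on UNIV"
    unfolding N using f by (intro summable_on_cmult_left) (simp add: wiener_series_def)
  show "wiener_series (\<lambda>t. f t * g t) (\<lambda>k. \<Sum>\<^sub>\<infinity>j. \<phi> j * \<psi> (k - j))"
  proof (rule wiener_series_cong[OF wiener_series_infsum[OF F sum]])
    fix t :: complex assume t: "t \<in> sphere 0 1"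
    have "((\<lambda>j. \<phi> j * t powi j * g t) has_sum f t * g t) UNIV"
      using f t by (intro has_sum_cmult_left) (auto simp: wiener_series_def)
    then show "(\<Sum>\<^sub>\<infinity>j. \<phi> j * (t powi j * g t)) = f t * g t"
      by (simp add: infsumI mult.assoc)
  qed simp
  have "(\<Sum>\<^sub>\<infinity>k. norm (\<Sum>\<^sub>\<infinity>j. \<phi> j * \<psi> (k - j))) \<le> (\<Sum>\<^sub>\<infinity>j. \<Sum>\<^sub>\<infinity>k. norm (\<phi> j * \<psi> (k - j)))"
    by (rule infsum_norm_triangle[OF _ sum]) (use F in \<open>simp add: wiener_series_def\<close>)
  then show "(\<Sum>\<^sub>\<infinity>k. norm (\<Sum>\<^sub>\<infinity>j. \<phi> j * \<psi> (k - j))) \<le> (\<Sum>\<^sub>\<infinity>k. norm (\<phi> k)) * (\<Sum>\<^sub>\<infinity>k. norm (\<psi> k))"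
    unfolding N by (simp add: infsum_cmult_left')
qed

text \<open>The set \<open>S\<close> is an additive semigroup of frequencies that may or may not
  contain 0. If it does not, as for the negative integers, the power 0 is the only one with a
  coefficient outside \<open>S\<close>.\<close>

lemma wiener_series_power:
  assumes f: "wiener_series f \<phi>" and \<phi>: "\<And>k. k \<notin> S \<Longrightarrow> \<phi> k = 0"
    and S: "\<And>j k. j \<in> S \<Longrightarrow> k \<in> S \<Longrightarrow> j + k \<in> S"
  shows "\<exists>\<psi>. wiener_series (\<lambda>t. f t ^ m) \<psi> \<and> (\<forall>k. k \<notin> S \<longrightarrow> \<psi> k = (if m = 0 \<and> k = 0 then 1 else 0)) \<and>
    (\<Sum>\<^sub>\<infinity>k. norm (\<psi> k)) \<le> (\<Sum>\<^sub>\<infinity>k. norm (\<phi> k)) ^ m"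
proof (induction m)
  case 0
  have "(\<Sum>\<^sub>\<infinity>k. norm (if k = (0::int) then 1 else 0 :: complex)) = 1"
    by (rule infsumI, rule has_sum_finite_neutralI[of "{0}"]) (auto split: if_splits)
  then show ?case
    using wiener_series_const[of 1] by (intro exI[of _ "\<lambda>k. if k = 0 then 1 else 0"]) simp
next
  case (Suc m)
  then obtain \<psi> where \<psi>: "wiener_series (\<lambda>t. f t ^ m) \<psi>"
      "\<And>k. k \<notin> S \<Longrightarrow> \<psi> k = (if m = 0 \<and> k = 0 then 1 else 0)"
      "(\<Sum>\<^sub>\<infinity>k. norm (\<psi> k)) \<le> (\<Sum>\<^sub>\<infinity>k. norm (\<phi> k)) ^ m"
    by blast
  \<comment> \<open>For \<open>j\<close> in \<open>S\<close> and \<open>k\<close> outside,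
    \<open>k - j\<close> lies outside \<open>S\<close> and differs from 0, so even the exceptional
    case \<open>m = 0\<close> contributes nothing.\<close>
  have "\<phi> j * \<psi> (k - j) = 0" if "k \<notin> S" for j k
    using S[of j "k - j"] that \<phi>[of j] \<psi>(2)[of "k - j"] by (cases "j \<in> S"; cases "j = k") auto
  then have "(\<Sum>\<^sub>\<infinity>j. \<phi> j * \<psi> (k - j)) = 0" if "k \<notin> S" for k
    using that by (intro infsum_0)
  moreover have "(\<Sum>\<^sub>\<infinity>k. norm (\<Sum>\<^sub>\<infinity>j. \<phi> j * \<psi> (k - j))) \<le> (\<Sum>\<^sub>\<infinity>k. norm (\<phi> k)) ^ Suc m"
    using wiener_series_mult(2)[OF f \<psi>(1)] mult_left_mono[OF \<psi>(3), of "\<Sum>\<^sub>\<infinity>k. norm (\<phi> k)"]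
    by (simp add: infsum_nonneg)
  ultimately show ?case
    using wiener_series_mult(1)[OF f \<psi>(1)]
    by (intro exI[of _ "\<lambda>k. \<Sum>\<^sub>\<infinity>j. \<phi> j * \<psi> (k - j)"]) simp
qed

text \<open>The exponential series converges in the Wiener algebra because the l1 norms of the
  powers grow at most geometrically. The support statement makes the exponential of a one-sided
  series one-sided again.\<close>

lemma wiener_series_exp:
  assumes f: "wiener_series f \<phi>" and \<phi>: "\<And>k. k \<notin> S \<Longrightarrow> \<phi> k = 0"
    and S: "\<And>j k. j \<in> S \<Longrightarrow> k \<in> S \<Longrightarrow> j + k \<in> S"
  obtains \<psi> where "wiener_series (\<lambda>t. exp (f t)) \<psi>" "\<And>k. k \<notin> S \<Longrightarrow> \<psi> k = (if k = 0 then 1 else 0)"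
proof -
  let ?N = "\<Sum>\<^sub>\<infinity>k. norm (\<phi> k)"
  obtain \<psi> where \<psi>: "\<And>m. wiener_series (\<lambda>t. f t ^ m) (\<psi> m)"
      "\<And>m k. k \<notin> S \<Longrightarrow> \<psi> m k = (if m = 0 \<and> k = 0 then 1 else 0)"
      "\<And>m. (\<Sum>\<^sub>\<infinity>k. norm (\<psi> m k)) \<le> ?N ^ m"
  proof -
    have "\<forall>m. \<exists>\<psi>. wiener_series (\<lambda>t. f t ^ m) \<psi> \<and>
        (\<forall>k. k \<notin> S \<longrightarrow> \<psi> k = (if m = 0 \<and> k = 0 then 1 else 0)) \<and> (\<Sum>\<^sub>\<infinity>k. norm (\<psi> k)) \<le> ?N ^ m"
      by (intro allI wiener_series_power[OF f \<phi> S])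
    from choice[OF this] show ?thesis
      by (elim exE) (rule that, blast+)
  qed
  have F: "wiener_series (\<lambda>t. inverse (fact m) * f t ^ m) (\<lambda>k. inverse (fact m) * \<psi> m k)" for m
    by (intro wiener_series_cmult \<psi>(1))
  have "(\<lambda>m. norm (?N ^ m /\<^sub>R fact m)) summable_on UNIV"
    using summable_norm_exp[of ?N] by (subst summable_on_UNIV_nonneg_real_iff) auto
  then have sum: "(\<lambda>m. \<Sum>\<^sub>\<infinity>k. norm (inverse (fact m) * \<psi> m k)) summable_on UNIV"
  proof (rule summable_on_comparison_test)
    fix m
    have "(\<Sum>\<^sub>\<infinity>k. norm (inverse (fact m) * \<psi> m k)) = inverse (fact m) * (\<Sum>\<^sub>\<infinity>k. norm (\<psi> m k))"
      by (simp add: norm_mult norm_inverse infsum_cmult_right')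
    also have "\<dots> \<le> inverse (fact m) * ?N ^ m"
      by (intro mult_left_mono \<psi>(3)) auto
    also have "\<dots> \<le> norm (?N ^ m /\<^sub>R fact m)"
      by simp
    finally show "(\<Sum>\<^sub>\<infinity>k. norm (inverse (fact m) * \<psi> m k)) \<le> norm (?N ^ m /\<^sub>R fact m)" .
  qed (simp add: infsum_nonneg)
  have "wiener_series (\<lambda>t. exp (f t)) (\<lambda>k. \<Sum>\<^sub>\<infinity>m. inverse (fact m) * \<psi> m k)"
  proof (rule wiener_series_cong[OF wiener_series_infsum[OF F sum]])
    fix t :: complex
    have "((\<lambda>m. f t ^ m /\<^sub>R fact m) has_sum exp (f t)) UNIV"
      by (rule norm_summable_imp_has_sum[OF summable_norm_exp exp_converges])
    then show "(\<Sum>\<^sub>\<infinity>m. inverse (fact m) * f t ^ m) = exp (f t)"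
      by (simp add: infsumI scaleR_conv_of_real)
  qed simp
  moreover have "(\<Sum>\<^sub>\<infinity>m. inverse (fact m) * \<psi> m k) = (if k = 0 then 1 else 0)" if "k \<notin> S" for k
    by (rule infsumI, rule has_sum_finite_neutralI[of "{0}"]) (auto simp: \<psi>(2)[OF that])
  ultimately show thesis
    by (rule that)
qed

section \<open>Uniqueness of Fourier series of continuous functions\<close>

lemma fourier_coeff_zero_imp_zero:
  assumes d: "continuous_on (sphere 0 1) d" and zero: "\<And>k. fourier_coeff d k = 0"
    and t: "t \<in> sphere 0 1"
  shows "d t = 0"
proof -
  \<comment> \<open>This space is closed under multiplication by polynomials in the real and imaginary part,
    so by Stone-Weierstrass \<open>d\<close> is orthogonal to itself.\<close>
  define Z where "Z = {g. continuous_on (sphere 0 1) g \<and> (\<forall>k. fourier_coeff g k = 0)}"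
  have Z_add: "(\<lambda>t. f t + g t) \<in> Z" if "f \<in> Z" "g \<in> Z" for f g
    using that by (auto simp: Z_def fourier_coeff_add intro!: continuous_intros)
  have Z_cmult: "(\<lambda>t. c * f t) \<in> Z" if "f \<in> Z" for f c
    using that by (auto simp: Z_def fourier_coeff_cmult intro!: continuous_intros)
  have Z_powi: "(\<lambda>t. t powi m * f t) \<in> Z" if "f \<in> Z" for f m
    using that by (auto simp: Z_def fourier_coeff_powi_mult intro!: continuous_intros)
  have Z_cong: "f \<in> Z" if "g \<in> Z" "\<And>t. t \<in> sphere 0 1 \<Longrightarrow> f t = g t" for f g
    using that fourier_coeff_cong[of f g] continuous_on_cong[OF refl, of "sphere 0 1" f g] by (auto simp: Z_def)
  have poly: "(\<lambda>t. complex_of_real (p t) * g t) \<in> Z" if "real_polynomial_function p" "g \<in> Z" for p g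
    using that
  proof (induction p arbitrary: g rule: real_polynomial_function.induct)
    case (linear h)
    interpret h: bounded_linear h by fact
    \<comment> \<open>On the circle Re t = (t + 1/t)/2 and Im t = (t - 1/t)/(2i); these are the
      resulting coefficients of t and 1/t in the real-linear form \<open>h\<close>.\<close>
    let ?a = "(h 1 - \<i> * h \<i>) / 2" and ?b = "(h 1 + \<i> * h \<i>) / 2"
    show ?case
    proof (rule Z_cong)
      show "(\<lambda>t. ?a * (t powi 1 * g t) + ?b * (t powi (-1) * g t)) \<in> Z"
        by (intro Z_add Z_cmult Z_powi linear)
      fix t :: complex assume "t \<in> sphere 0 1"
      then have "t * cnj t = 1"
        by (simp flip: complex_norm_square)
      then have inv: "inverse t = cnj t"
        by (rule inverse_unique)
      have "h t = h (Re t *\<^sub>R 1 + Im t *\<^sub>R \<i>)"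
        by (rule arg_cong[of _ _ h]) (simp add: complex_eq_iff)
      also have "\<dots> = Re t * h 1 + Im t * h \<i>"
        by (simp only: h.add h.scaleR real_scaleR_def)
      finally have "complex_of_real (h t) = ?a * t + ?b * cnj t"
        by (simp add: complex_eq_iff field_simps)
      then show "complex_of_real (h t) * g t = ?a * (t powi 1 * g t) + ?b * (t powi (-1) * g t)"
        by (simp add: power_int_minus inv algebra_simps)
    qed
  next
    case (const c)
    then show ?case by (rule Z_cmult)
  next
    case (add p q)
    then show ?case
      by (auto simp: distrib_right intro!: Z_add)
  next
    case (mult p q)
    then show ?case by (simp add: mult.assoc)
  qed
  have dZ: "d \<in> Z"
    using d zero by (simp add: Z_def)
  obtain B where B: "B > 0" "\<And>t. t \<in> sphere 0 1 \<Longrightarrow> norm (d t) \<le> B"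
    using compact_imp_bounded[OF compact_continuous_image[OF d compact_sphere]]
    unfolding bounded_pos by auto
  have bound: "norm (fourier_coeff (\<lambda>t. cnj (d t) * d t) 0) \<le> e" if "e > 0" for e
  proof -
    have "e / B > 0" using that B(1) by simp
    moreover have "continuous_on (sphere 0 1) (\<lambda>t. cnj (d t))"
      by (intro continuous_intros d)
    ultimately obtain P where P: "polynomial_function P" "\<And>t. t \<in> sphere 0 1 \<Longrightarrow> norm (cnj (d t) - P t) < e / B"
      using Stone_Weierstrass_polynomial_function[OF compact_sphere, of 0 1 "\<lambda>t. cnj (d t)" "e / B"]
      by metis
    have ReIm: "real_polynomial_function (\<lambda>t. Re (P t))" "real_polynomial_function (\<lambda>t. Im (P t))"
      using P(1) bounded_linear_Re bounded_linear_Im unfolding polynomial_function_def o_def by blast+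
    have PZ: "(\<lambda>t. P t * d t) \<in> Z"
    proof (rule Z_cong)
      show "(\<lambda>t. complex_of_real (Re (P t)) * d t + \<i> * (complex_of_real (Im (P t)) * d t)) \<in> Z"
        by (intro Z_add Z_cmult poly ReIm dZ)
      show "P t * d t = complex_of_real (Re (P t)) * d t + \<i> * (complex_of_real (Im (P t)) * d t)" for t
        by (subst complex_eq) (simp add: algebra_simps)
    qed
    then have cont: "continuous_on (sphere 0 1) (\<lambda>t. P t * d t)" "fourier_coeff (\<lambda>t. P t * d t) 0 = 0"
      by (simp_all add: Z_def)
    have "fourier_coeff (\<lambda>t. cnj (d t) * d t) 0 = fourier_coeff (\<lambda>t. cnj (d t) * d t - P t * d t) 0"
      by (simp add: fourier_coeff_diff cont d continuous_intros)
    also have "norm \<dots> \<le> e"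
    proof (rule norm_fourier_coeff_le)
      fix t :: complex assume t: "t \<in> sphere 0 1"
      have "norm (cnj (d t) * d t - P t * d t) = norm (cnj (d t) - P t) * norm (d t)"
        by (simp flip: norm_mult left_diff_distrib)
      also have "\<dots> \<le> e / B * B"
        using P(2)[OF t] B(2)[OF t] that B(1) by (intro mult_mono) auto
      finally show "norm (cnj (d t) * d t - P t * d t) \<le> e"
        using B(1) by simp
    qed (intro continuous_intros cont d)
    finally show ?thesis .
  qed
  have "norm (fourier_coeff (\<lambda>t. cnj (d t) * d t) 0) \<le> 0"
    by (rule field_le_epsilon) (use bound in simp)
  then have zero: "integral {0..2 * pi} (\<lambda>\<theta>. complex_of_real ((norm (d (cis \<theta>)))\<^sup>2)) = 0"
    by (simp add: fourier_coeff_cis complex_norm_square mult.commute del: of_real_power)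
  have cont: "continuous_on {0..2 * pi} (\<lambda>\<theta>. (norm (d (cis \<theta>)))\<^sup>2)"
    by (intro continuous_intros continuous_on_cis_compose d)
  have "((\<lambda>\<theta>. (norm (d (cis \<theta>)))\<^sup>2) has_integral
      integral {0..2 * pi} (\<lambda>\<theta>. (norm (d (cis \<theta>)))\<^sup>2)) {0..2 * pi}"
    by (intro integrable_integral integrable_continuous_interval cont)
  from integral_unique[OF has_integral_of_real[OF this, where 'b = complex]]
  have "integral {0..2 * pi} (\<lambda>\<theta>. (norm (d (cis \<theta>)))\<^sup>2) = 0"
    unfolding zero by (simp only: of_real_eq_0_iff eq_commute[of "0::complex"])
  with cont have eq: "\<forall>\<theta>\<in>{0..2 * pi}. (norm (d (cis \<theta>)))\<^sup>2 = 0"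
    by (subst (asm) integral_eq_0_iff) auto
  have "t = cis (Arg2pi t)"
    using t Arg2pi_eq[of t] by (simp add: cis_conv_exp)
  then show ?thesis
    using bspec[OF eq, of "Arg2pi t"] Arg2pi_ge_0[of t] Arg2pi_lt_2pi[of t] by simp
qed

text \<open>The Fourier series converges to some \<open>g\<close> with the same coefficients as
  \<open>f\<close>; uniqueness, applied to the difference, gives \<open>f = g\<close> on the
  circle.\<close>

lemma wiener_series_fourier:
  assumes f: "continuous_on (sphere 0 1) f" and sum: "(\<lambda>k. norm (fourier_coeff f k)) summable_on UNIV"
  shows "wiener_series f (fourier_coeff f)"
proof -
  define g where "g t = (\<Sum>\<^sub>\<infinity>k. fourier_coeff f k * t powi k)" for t
  have g: "wiener_series g (fourier_coeff f)"
    unfolding wiener_series_def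
  proof (intro conjI ballI sum)
    fix t :: complex assume t: "t \<in> sphere 0 1"
    have "(\<lambda>k. norm (fourier_coeff f k * t powi k)) summable_on UNIV"
      using sum t by (simp add: norm_mult norm_power_int)
    then have "(\<lambda>k. fourier_coeff f k * t powi k) summable_on UNIV"
      by (rule abs_summable_summable)
    then show "((\<lambda>k. fourier_coeff f k * t powi k) has_sum g t) UNIV"
      unfolding g_def by (rule has_sum_infsum)
  qed
  note cont = wiener_series_continuous[OF g]
  have "f t - g t = 0" if "t \<in> sphere 0 1" for t
    using that by (intro fourier_coeff_zero_imp_zero[where d = "\<lambda>t. f t - g t"])
      (auto simp: fourier_coeff_diff f cont wiener_series_fourier_coeff[OF g] intro!: continuous_intros)
  then show ?thesis
    by (intro wiener_series_cong[OF g]) auto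
qed

section \<open>Bernstein's theorem on absolute convergence\<close>

lemma norm_cis_diff_one_le: "norm (cis h - 1) \<le> \<bar>h\<bar>"
proof -
  have "(norm (cis h - 1))\<^sup>2 = (cos h - 1)\<^sup>2 + (sin h)\<^sup>2"
    by (simp add: cmod_power2)
  also have "\<dots> = (2 * sin (h / 2))\<^sup>2"
    using cos_double_sin[of "h / 2"] sin_cos_squared_add[of h]
    by (simp add: power2_eq_square algebra_simps)
  finally have "(norm (cis h - 1))\<^sup>2 = (2 * sin (h / 2))\<^sup>2" .
  from arg_cong[OF this, of sqrt] have "norm (cis h - 1) = \<bar>2 * sin (h / 2)\<bar>"
    by (simp only: real_sqrt_abs abs_norm_cancel)
  also have "\<dots> \<le> \<bar>h\<bar>"
    using abs_sin_x_le_abs_x[of "h / 2"] by (simp add: abs_mult)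
  finally show ?thesis .
qed

text \<open>Arithmetic of one dyadic block: a block has at most \<open>2 * 2 ^ m\<close>
  frequencies, so Cauchy-Schwarz costs a factor of order 2^(m/2), while the Hoelder condition at
  scale \<open>h\<close> gains 2^(-\<alpha> m). The leading 2 rounds up the square root of
  2.\<close>

lemma dyadic_scale_bound:
  fixes C h \<alpha> S :: real
  assumes h: "h = pi / 2 / 2 ^ m" and C: "0 \<le> C" and S: "S\<^sup>2 \<le> (C * h powr \<alpha>)\<^sup>2 * (2 * 2 ^ m)"
  shows "S \<le> 2 * C * (pi / 2) powr \<alpha> * (2 powr (1/2 - \<alpha>)) ^ m"
proof -
  let ?B = "C * h powr \<alpha>"
  have two: "(2::real) ^ m = 2 powr m"
    by (simp add: powr_realpow)
  have p2: "(2 powr (m / 2))\<^sup>2 = (2::real) ^ m"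
    by (simp add: power2_eq_square powr_realpow flip: powr_add)
  have "0 \<le> ?B\<^sup>2 * 2 ^ m"
    by simp
  moreover have "?B\<^sup>2 * (2 * 2 ^ m) = 2 * (?B\<^sup>2 * 2 ^ m)"
    by simp
  ultimately have "S\<^sup>2 \<le> 4 * (?B\<^sup>2 * 2 ^ m)"
    using S by linarith
  also have "\<dots> = 4 * ?B\<^sup>2 * (2 powr (m / 2))\<^sup>2"
    unfolding p2 by simp
  also have "\<dots> = (2 * ?B * 2 powr (m / 2))\<^sup>2"
    by (simp only: power_mult_distrib) simp
  finally have "S \<le> 2 * ?B * 2 powr (m / 2)"
    by (rule power2_le_imp_le) (simp add: C)
  then have le: "S \<le> 2 * C * (h powr \<alpha> * 2 powr (m / 2))"
    by (simp add: mult.assoc)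
  have "h powr \<alpha> = (pi / 2) powr \<alpha> / 2 powr (\<alpha> * m)"
    unfolding h two using powr_divide[of "pi / 2" "2 powr m" \<alpha>] by (simp add: powr_powr mult.commute)
  then have "h powr \<alpha> * 2 powr (m / 2) = (pi / 2) powr \<alpha> * 2 powr (m / 2 - \<alpha> * m)"
    by (simp add: powr_diff)
  also have "m / 2 - \<alpha> * m = (1/2 - \<alpha>) * m"
    by (simp add: algebra_simps)
  also have "2 powr ((1/2 - \<alpha>) * m) = (2 powr (1/2 - \<alpha>)) ^ m"
    by (simp add: powr_realpow flip: powr_powr)
  finally show ?thesis
    using le by (simp only: mult.assoc)
qed

text \<open>Bessel's inequality is applied to the difference between a rotation of \<open>f\<close>
  and \<open>f\<close> itself, whose coefficients dominate those of \<open>f\<close> on the block.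
  Cauchy-Schwarz then passes from the sum of squares to the sum.\<close>

lemma fourier_coeff_dyadic_block_le:
  assumes f: "continuous_on (sphere 0 1) f" and "0 \<le> C"
    and holder: "\<And>h t. 0 < h \<Longrightarrow> t \<in> sphere 0 1 \<Longrightarrow> norm (f (cis h * t) - f t) \<le> C * h powr \<alpha>"
  shows "(\<Sum>k | 2 ^ m \<le> \<bar>k\<bar> \<and> \<bar>k\<bar> < 2 ^ Suc m. norm (fourier_coeff f k))
    \<le> 2 * C * (pi / 2) powr \<alpha> * (2 powr (1/2 - \<alpha>)) ^ m"
proof -
  let ?D = "{k::int. 2 ^ m \<le> \<bar>k\<bar> \<and> \<bar>k\<bar> < 2 ^ Suc m}"
  let ?c = "fourier_coeff f"
  \<comment> \<open>Chosen so that \<open>\<bar>k h\<bar>\<close> lies between \<open>pi / 2\<close> and \<open>pi\<close> on the block, where the rotation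
    multiplier \<open>cis (k h) - 1\<close> has modulus at least 1.\<close>
  define h where "h = pi / 2 / 2 ^ m"
  have "pi / 2 / 2 ^ m \<le> pi / 2 / 1"
    by (rule divide_left_mono) auto
  then have h: "0 < h" "h \<le> 2 * pi"
    using pi_gt_zero unfolding h_def by (simp, linarith)
  let ?B = "C * h powr \<alpha>"
  have D_sub: "?D \<subseteq> {- (2 ^ Suc m)<..<- (2 ^ m) + 1} \<union> {2 ^ m..<2 ^ Suc m}"
    by auto
  have "finite ?D"
    by (rule finite_subset[OF D_sub]) auto
  have "card ?D \<le> card {- (2 ^ Suc m)<..<- (2 ^ m) + 1 :: int} + card {2 ^ m..<2 ^ Suc m :: int}"
    by (rule order_trans[OF card_mono[OF _ D_sub] card_Un_le]) auto
  also have "\<dots> = 2 * 2 ^ m"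
    by (simp add: nat_power_eq)
  finally have "card ?D \<le> 2 * 2 ^ m" .
  from of_nat_mono[OF this, where 'a = real] have card: "real (card ?D) \<le> 2 * 2 ^ m"
    by (simp only: of_nat_mult of_nat_numeral of_nat_power)
  have rot: "continuous_on (sphere 0 1) (\<lambda>t. f (cis h * t))"
    by (rule continuous_on_compose2[OF f]) (auto intro!: continuous_intros simp: norm_mult)
  have big: "1 \<le> norm (cis h powi k - 1)" if "k \<in> ?D" for k
  proof -
    have "2 ^ m \<le> \<bar>k\<bar>" "\<bar>k\<bar> \<le> 2 ^ Suc m"
      using that by auto
    then have "real_of_int (2 ^ m) \<le> real_of_int \<bar>k\<bar>" "real_of_int \<bar>k\<bar> \<le> real_of_int (2 ^ Suc m)"
      by (simp_all only: of_int_le_iff)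
    then have "2 ^ m \<le> real_of_int \<bar>k\<bar>" "real_of_int \<bar>k\<bar> \<le> 2 ^ Suc m"
      by (simp_all only: of_int_power of_int_numeral)
    then have "pi / 2 \<le> real_of_int \<bar>k\<bar> * h" "real_of_int \<bar>k\<bar> * h \<le> pi"
      by (auto simp: h_def field_simps)
    then have "cos (real_of_int \<bar>k\<bar> * h) \<le> 0"
      using cos_monotone_0_pi_le[of "pi / 2" "real_of_int \<bar>k\<bar> * h"] by simp
    moreover have "cos (real_of_int \<bar>k\<bar> * h) = cos (real_of_int k * h)"
      by (cases "k \<ge> 0") auto
    moreover have "\<bar>Re (cis h powi k - 1)\<bar> \<le> norm (cis h powi k - 1)"
      by (rule abs_Re_le_cmod)
    ultimately show ?thesis
      by (simp add: cis_powi)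
  qed
  have "(\<Sum>k\<in>?D. (norm (?c k))\<^sup>2) \<le> (\<Sum>k\<in>?D. (norm (fourier_coeff (\<lambda>t. f (cis h * t) - f t) k))\<^sup>2)"
  proof (rule sum_mono)
    fix k assume k: "k \<in> ?D"
    have "fourier_coeff (\<lambda>t. f (cis h * t) - f t) k = (cis h powi k - 1) * ?c k"
      using h by (simp add: fourier_coeff_diff[OF rot f] fourier_coeff_rotate[OF f] left_diff_distrib)
    moreover have "1 * norm (?c k) \<le> norm (cis h powi k - 1) * norm (?c k)"
      by (intro mult_right_mono big k) auto
    ultimately show "(norm (?c k))\<^sup>2 \<le> (norm (fourier_coeff (\<lambda>t. f (cis h * t) - f t) k))\<^sup>2"
      by (intro power_mono) (auto simp: norm_mult)
  qed
  also have "\<dots> \<le> ?B\<^sup>2"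
  proof (rule bessel)
    show "norm (f (cis h * t) - f t) \<le> ?B" if "t \<in> sphere 0 1" for t
      using h(1) that by (rule holder)
  qed (use \<open>finite ?D\<close> in \<open>auto intro!: continuous_intros rot f\<close>)
  finally have sq: "(\<Sum>k\<in>?D. (norm (?c k))\<^sup>2) \<le> ?B\<^sup>2" .
  have cs: "(\<Sum>k\<in>?D. norm (?c k) * 1)\<^sup>2 \<le> (\<Sum>k\<in>?D. (norm (?c k))\<^sup>2) * (\<Sum>k\<in>?D. 1\<^sup>2)"
    by (rule Cauchy_Schwarz_ineq_sum[of "\<lambda>k. norm (?c k)" "\<lambda>_. 1"])
  have "(\<Sum>k\<in>?D. 1\<^sup>2) = real (card ?D)"
    by (simp only: power_one sum_constant mult_1_right)
  then have "(\<Sum>k\<in>?D. 1\<^sup>2) \<le> (2 * 2 ^ m :: real)"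
    using card by (simp only:)
  moreover have "0 \<le> (\<Sum>k\<in>?D. 1\<^sup>2 :: real)"
    by (intro sum_nonneg) simp
  ultimately have le1: "(\<Sum>k\<in>?D. (norm (?c k))\<^sup>2) * (\<Sum>k\<in>?D. 1\<^sup>2) \<le> ?B\<^sup>2 * (2 * 2 ^ m)"
    by (intro mult_mono[OF sq] zero_le_power2)
  have "(\<Sum>k\<in>?D. norm (?c k))\<^sup>2 \<le> ?B\<^sup>2 * (2 * 2 ^ m)"
    using order_trans[OF cs le1] by (simp only: mult_1_right)
  then show ?thesis
    by (rule dyadic_scale_bound[OF h_def \<open>0 \<le> C\<close>])
qed

text \<open>The block bounds form a geometric series with ratio \<open>q\<close>, and
  \<open>q < 1\<close> is exactly the condition that \<open>\<alpha>\<close> exceeds 1/2. The index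
  0 lies in no dyadic block, hence the separate term \<open>?c 0\<close>.\<close>

theorem bernstein_summable:
  assumes f: "continuous_on (sphere 0 1) f" and \<alpha>: "1/2 < \<alpha>"
    and holder: "\<And>h t. 0 < h \<Longrightarrow> t \<in> sphere 0 1 \<Longrightarrow> norm (f (cis h * t) - f t) \<le> C * h powr \<alpha>"
  shows "(\<lambda>k. norm (fourier_coeff f k)) summable_on UNIV"
proof -
  have "0 \<le> norm (f (cis 1 * 1) - f 1)"
    by simp
  also have "\<dots> \<le> C * 1 powr \<alpha>"
    by (rule holder) auto
  finally have C: "0 \<le> C"
    by simp
  let ?c = "\<lambda>k. norm (fourier_coeff f k)"
  define K where "K = 2 * C * (pi / 2) powr \<alpha>"
  define q :: real where "q = 2 powr (1/2 - \<alpha>)"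
  have q: "0 \<le> q" "q < 1" and K: "0 \<le> K"
    using \<alpha> C by (auto simp: q_def K_def powr_less_one)
  have fin: "finite {k::int. \<bar>k\<bar> < x}" for x
    by (rule finite_subset[of _ "{-x..x}"]) auto
  have block: "(\<Sum>k | \<bar>k\<bar> < 2 ^ M. ?c k) \<le> ?c 0 + (\<Sum>m<M. K * q ^ m)" for M
  proof (induction M)
    case 0
    have "{k::int. \<bar>k\<bar> < 2 ^ 0} = {0}" by auto
    then show ?case by simp
  next
    case (Suc M)
    let ?A = "{k::int. \<bar>k\<bar> < 2 ^ M}" and ?D = "{k::int. 2 ^ M \<le> \<bar>k\<bar> \<and> \<bar>k\<bar> < 2 ^ Suc M}"
    have split: "{k::int. \<bar>k\<bar> < 2 ^ Suc M} = ?A \<union> ?D"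
      by auto
    have "finite ?D"
      by (rule finite_subset[OF _ fin[of "2 ^ Suc M"]]) blast
    moreover have "?A \<inter> ?D = {}"
      by auto
    ultimately have "(\<Sum>k | \<bar>k\<bar> < 2 ^ Suc M. ?c k) = sum ?c ?A + sum ?c ?D"
      unfolding split using fin by (intro sum.union_disjoint)
    also have "(\<Sum>k | 2 ^ M \<le> \<bar>k\<bar> \<and> \<bar>k\<bar> < 2 ^ Suc M. ?c k) \<le> K * q ^ M"
      unfolding K_def q_def by (rule fourier_coeff_dyadic_block_le[OF f C holder])
    finally show ?case
      using Suc by simp
  qed
  have "sum ?c F \<le> ?c 0 + K / (1 - q)" if F: "finite F" for F
  proof -
    obtain M where M: "F \<subseteq> {k. \<bar>k\<bar> < 2 ^ M}"
    proof -
      obtain N where N: "\<And>k. k \<in> F \<Longrightarrow> nat \<bar>k\<bar> \<le> N"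
        using F finite_nat_set_iff_bounded_le[of "(\<lambda>k. nat \<bar>k\<bar>) ` F"] by (meson finite_imageI image_eqI)
      have "int N < int (2 ^ N)"
        by (simp only: of_nat_less_iff less_exp)
      then have "int N < 2 ^ N"
        by simp
      moreover have "\<bar>k\<bar> \<le> int N" if "k \<in> F" for k
        using N[OF that] by simp
      ultimately have "\<bar>k\<bar> < 2 ^ N" if "k \<in> F" for k
        using that by (meson le_less_trans)
      then show ?thesis
        by (intro that[of N]) blast
    qed
    have "sum ?c F \<le> (\<Sum>k | \<bar>k\<bar> < 2 ^ M. ?c k)"
      using M fin by (intro sum_mono2) auto
    also have "\<dots> \<le> ?c 0 + (\<Sum>m<M. K * q ^ m)"
      by (rule block)
    also have "(\<Sum>m<M. K * q ^ m) = K * (\<Sum>m<M. q ^ m)"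
      by (simp add: sum_distrib_left)
    also have "(\<Sum>m<M. q ^ m) \<le> 1 / (1 - q)"
      using q sum_le_suminf[OF summable_geometric, of q "{..<M}"] by (simp add: suminf_geometric)
    then have "K * (\<Sum>m<M. q ^ m) \<le> K * (1 / (1 - q))"
      using K by (rule mult_left_mono)
    finally show ?thesis by simp
  qed
  then have "bdd_above (sum ?c ` {F. F \<subseteq> UNIV \<and> finite F})"
    by (intro bdd_aboveI2[where M = "?c 0 + K / (1 - q)"]) blast
  then show ?thesis
    by (intro nonneg_bdd_above_summable_on) simp_all
qed

section \<open>Hoelder symbols and their Wiener-Hopf factors in the Wiener algebra\<close>

definition wiener :: "(complex \<Rightarrow> complex) \<Rightarrow> bool" where
  "wiener f \<longleftrightarrow> wiener_series f (fourier_coeff f)"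

lemma wienerI:
  assumes "wiener_series f \<phi>"
  shows "wiener f" and "fourier_coeff f k = \<phi> k"
  using assms wiener_series_fourier_coeff[OF assms] by (simp_all add: wiener_def)

text \<open>For \<open>\<beta>\<close> below 1, Bernstein's theorem applies with exponent
  \<open>\<beta>\<close> itself. Otherwise the first derivative is continuous, hence bounded on the
  circle, and the mean value inequality gives a Lipschitz condition, that is, exponent 1.\<close>

lemma holder_class_wiener:
  assumes "f \<in> holder_class \<beta>" and \<beta>: "1/2 < \<beta>"
  shows "wiener f"
proof -
  from assms(1) obtain D C where D0: "D 0 = f"
    and deriv: "\<And>m \<theta>. m < nat \<lfloor>\<beta>\<rfloor> \<Longrightarrow> ((\<lambda>x. D m (cis x)) has_vector_derivative D (Suc m) (cis \<theta>)) (at \<theta>)"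
    and cont: "\<And>m. m \<le> nat \<lfloor>\<beta>\<rfloor> \<Longrightarrow> continuous_on (sphere 0 1) (D m)"
    and holder: "\<And>s t. s \<in> sphere 0 1 \<Longrightarrow> t \<in> sphere 0 1 \<Longrightarrow>
      dist (D (nat \<lfloor>\<beta>\<rfloor>) s) (D (nat \<lfloor>\<beta>\<rfloor>) t) \<le> C * dist s t powr (\<beta> - of_int \<lfloor>\<beta>\<rfloor>)"
    unfolding holder_class_def by blast
  have f: "continuous_on (sphere 0 1) f"
    using cont[of 0] by (simp add: D0)
  have "(\<lambda>k. norm (fourier_coeff f k)) summable_on UNIV"
  proof (cases "nat \<lfloor>\<beta>\<rfloor> = 0")
    case True
    then have \<beta>0: "\<lfloor>\<beta>\<rfloor> = 0"
      using \<beta> by (simp add: nat_eq_iff)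
    have H: "norm (f s - f t) \<le> C * norm (s - t) powr \<beta>" if "s \<in> sphere 0 1" "t \<in> sphere 0 1" for s t
      using holder[OF that] by (simp add: \<beta>0 D0 dist_norm)
    \<comment> \<open>The constant in the class carries no sign; comparing two distinct points
      forces it to be nonnegative, as the monotonicity step below requires.\<close>
    have "0 \<le> norm (f 1 - f (-1))" by simp
    also have "\<dots> \<le> C * norm (1 - (-1) :: complex) powr \<beta>"
      by (rule H) auto
    finally have C: "0 \<le> C"
      by (simp add: zero_le_mult_iff)
    show ?thesis
    proof (rule bernstein_summable[OF f \<beta>])
      fix h :: real and t :: complex assume h: "0 < h" and t: "t \<in> sphere 0 1"
      have "norm (f (cis h * t) - f t) \<le> C * norm (cis h * t - t) powr \<beta>"
        using t by (intro H) (auto simp: norm_mult)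
      also have "norm (cis h * t - t) = norm (cis h - 1)"
        using t norm_mult[of "cis h - 1" t] by (simp add: algebra_simps)
      also have "C * norm (cis h - 1) powr \<beta> \<le> C * h powr \<beta>"
        using norm_cis_diff_one_le[of h] h C \<beta> by (intro mult_left_mono powr_mono2) auto
      finally show "norm (f (cis h * t) - f t) \<le> C * h powr \<beta>" .
    qed
  next
    case False
    have "bounded (D 1 ` sphere 0 1)"
      using cont[of 1] False by (intro compact_imp_bounded compact_continuous_image) auto
    then obtain B where B: "\<And>t. t \<in> sphere 0 1 \<Longrightarrow> norm (D 1 t) \<le> B"
      unfolding bounded_iff by blast
    have d: "((\<lambda>x. f (cis x)) has_vector_derivative D 1 (cis \<theta>)) (at \<theta>)" for \<theta>
      using deriv[of 0 \<theta>] False by (simp add: D0)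
    show ?thesis
    proof (rule bernstein_summable[OF f, of 1 B])
      fix h :: real and t :: complex assume h: "0 < h" and t: "t \<in> sphere 0 1"
      define x where "x = Arg2pi t"
      have t_eq: "t = cis x"
        using t Arg2pi_eq[of t] by (simp add: x_def cis_conv_exp)
      have "\<exists>y\<in>{x<..<x + h}. norm (f (cis (x + h)) - f (cis x)) \<le> norm ((x + h - x) *\<^sub>R D 1 (cis y))"
      proof (rule mvt_general)
        show "continuous_on {x..x + h} (\<lambda>x. f (cis x))"
          by (rule continuous_on_cis_compose[OF f])
      qed (use h d in \<open>auto simp: has_vector_derivative_def\<close>)
      then obtain y where "norm (f (cis (x + h)) - f (cis x)) \<le> h * norm (D 1 (cis y))"
        using h by auto
      also have "\<dots> \<le> h * B"
        using h B[of "cis y"] by simp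
      finally have "norm (f (cis (x + h)) - f (cis x)) \<le> h * B" .
      then show "norm (f (cis h * t) - f t) \<le> B * h powr 1"
        using h by (simp add: t_eq cis_mult add.commute mult.commute)
    qed simp
  qed
  then show ?thesis
    unfolding wiener_def by (rule wiener_series_fourier[OF f])
qed

lemma wiener_mult:
  assumes "wiener f" "wiener g"
  shows "wiener (\<lambda>t. f t * g t)"
    and "fourier_coeff (\<lambda>t. f t * g t) k = (\<Sum>\<^sub>\<infinity>j. fourier_coeff f j * fourier_coeff g (k - j))"
  using wienerI[OF wiener_series_mult(1)] assms by (auto simp: wiener_def)

lemma wiener_tilde:
  assumes "wiener f"
  shows "wiener (tilde f)" and "fourier_coeff (tilde f) k = fourier_coeff f (- k)"
  using wienerI[OF wiener_series_tilde] assms by (auto simp: wiener_def)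

lemma wiener_summable: "wiener f \<Longrightarrow> (\<lambda>k. norm (fourier_coeff f k)) summable_on UNIV"
  by (simp add: wiener_def wiener_series_def)

text \<open>Serves all four functions at once: \<open>S\<close> is \<open>{0..}\<close> or
  \<open>{..<0}\<close>, and \<open>c\<close> is 1 for a factor and -1 for its inverse. Formula and
  conclusion concern only the values on the circle.\<close>

lemma wiener_exp_half:
  assumes "wiener f" and S: "\<And>j k. j \<in> S \<Longrightarrow> k \<in> S \<Longrightarrow> j + k \<in> S"
    and g: "\<And>t. t \<in> sphere 0 1 \<Longrightarrow> g t = exp (c * (\<Sum>\<^sub>\<infinity>k\<in>S. fourier_coeff f k * t powi k))"
  shows "wiener g" and "k \<notin> S \<Longrightarrow> fourier_coeff g k = (if k = 0 then 1 else 0)"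
proof -
  have "wiener_series (\<lambda>t. c * (\<Sum>\<^sub>\<infinity>k\<in>S. fourier_coeff f k * t powi k))
      (\<lambda>k. c * (if k \<in> S then fourier_coeff f k else 0))"
    using assms(1) unfolding wiener_def by (intro wiener_series_cmult wiener_series_restrict)
  then obtain \<psi> where \<psi>: "wiener_series (\<lambda>t. exp (c * (\<Sum>\<^sub>\<infinity>k\<in>S. fourier_coeff f k * t powi k))) \<psi>"
      "\<And>k. k \<notin> S \<Longrightarrow> \<psi> k = (if k = 0 then 1 else 0)"
    by (rule wiener_series_exp[where S = S]) (use S in auto)
  have "wiener_series g \<psi>"
    by (rule wiener_series_cong[OF \<psi>(1)]) (simp_all add: g)
  from wienerI[OF this] \<psi>(2) show "wiener g" and "k \<notin> S \<Longrightarrow> fourier_coeff g k = (if k = 0 then 1 else 0)"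
    by simp_all
qed

lemma wiener_has_sum_half:
  assumes "wiener f" "t \<in> sphere 0 1"
  shows "((\<lambda>k. fourier_coeff f k * t powi k) has_sum (\<Sum>\<^sub>\<infinity>k\<in>S. fourier_coeff f k * t powi k)) S"
proof (rule has_sum_infsum)
  have "(\<lambda>k. fourier_coeff f k * t powi k) summable_on UNIV"
    using assms by (auto simp: wiener_def wiener_series_def intro: has_sum_imp_summable)
  then show "(\<lambda>k. fourier_coeff f k * t powi k) summable_on S"
    by (rule summable_on_subset) auto
qed

lemma wh_plus_eq:
  assumes "wiener f" "t \<in> sphere 0 1"
  shows "wh_plus f t = exp (\<Sum>\<^sub>\<infinity>k\<in>{0..}. fourier_coeff f k * t powi k)"
proof -
  have "((\<lambda>k. fourier_coeff f (int k) * t ^ k) has_sum (\<Sum>\<^sub>\<infinity>k\<in>{0..}. fourier_coeff f k * t powi k)) UNIV"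
    by (subst has_sum_reindex_bij_witness[of _ nat int "{0..}" "\<lambda>k. fourier_coeff f k * t powi k", OF _ _ _ _ _ refl])
      (auto intro!: wiener_has_sum_half assms)
  then show ?thesis
    unfolding wh_plus_def by (subst sums_unique[OF has_sum_imp_sums, symmetric]) auto
qed

lemma wh_minus_eq:
  assumes "wiener f" "t \<in> sphere 0 1"
  shows "wh_minus f t = exp (\<Sum>\<^sub>\<infinity>k\<in>{..<0}. fourier_coeff f k * t powi k)"
proof -
  have "((\<lambda>k. fourier_coeff f (- int (Suc k)) * t powi (- int (Suc k))) has_sum
      (\<Sum>\<^sub>\<infinity>k\<in>{..<0}. fourier_coeff f k * t powi k)) UNIV"
    by (subst has_sum_reindex_bij_witness[of _ "\<lambda>k. nat (- k - 1)" "\<lambda>k. - int (Suc k)" "{..<0}"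
        "\<lambda>k. fourier_coeff f k * t powi k", OF _ _ _ _ _ refl])
      (auto intro!: wiener_has_sum_half assms)
  then show ?thesis
    unfolding wh_minus_def by (subst sums_unique[OF has_sum_imp_sums, symmetric]) auto
qed

lemma wiener_wh_plus:
  assumes "wiener f"
  shows "wiener (wh_plus f)" and "wiener (\<lambda>t. inverse (wh_plus f t))"
    and "k < 0 \<Longrightarrow> fourier_coeff (wh_plus f) k = 0"
    and "k < 0 \<Longrightarrow> fourier_coeff (\<lambda>t. inverse (wh_plus f t)) k = 0"
  using wiener_exp_half[OF assms, of "{0..}" "wh_plus f" 1]
    wiener_exp_half[OF assms, of "{0..}" "\<lambda>t. inverse (wh_plus f t)" "-1"]
  by (simp_all add: wh_plus_eq[OF assms] exp_minus)

text \<open>Since 0 lies outside \<open>{..<0}\<close>, the constant coefficient is that of the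
  power 0 of the exponent, namely 1. This normalization later makes the triangular matrices
  unipotent.\<close>

lemma wiener_wh_minus:
  assumes "wiener f"
  shows "wiener (wh_minus f)" and "wiener (\<lambda>t. inverse (wh_minus f t))"
    and "k > 0 \<Longrightarrow> fourier_coeff (wh_minus f) k = 0"
    and "k > 0 \<Longrightarrow> fourier_coeff (\<lambda>t. inverse (wh_minus f t)) k = 0"
    and "fourier_coeff (wh_minus f) 0 = 1"
  using wiener_exp_half[OF assms, of "{..<0}" "wh_minus f" 1]
    wiener_exp_half[OF assms, of "{..<0}" "\<lambda>t. inverse (wh_minus f t)" "-1"]
  by (simp_all add: wh_minus_eq[OF assms] exp_minus)

lemma wh_factorization:
  assumes f: "wiener f" and t: "t \<in> sphere 0 1"
  shows "wh_minus f t * wh_plus f t = exp (f t)"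
proof -
  have "((\<lambda>k. fourier_coeff f k * t powi k) has_sum
      ((\<Sum>\<^sub>\<infinity>k\<in>{..<0}. fourier_coeff f k * t powi k) + (\<Sum>\<^sub>\<infinity>k\<in>{0..}. fourier_coeff f k * t powi k))) ({..<0} \<union> {0..})"
    by (intro has_sum_Un_disjoint wiener_has_sum_half f t) auto
  moreover have "{..<0} \<union> {0..} = (UNIV :: int set)" by auto
  ultimately have halves: "((\<lambda>k. fourier_coeff f k * t powi k) has_sum
      ((\<Sum>\<^sub>\<infinity>k\<in>{..<0}. fourier_coeff f k * t powi k) + (\<Sum>\<^sub>\<infinity>k\<in>{0..}. fourier_coeff f k * t powi k))) UNIV"
    by (simp only:)
  have "((\<lambda>k. fourier_coeff f k * t powi k) has_sum f t) UNIV"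
    using f t by (simp add: wiener_def wiener_series_def)
  from has_sum_unique[OF this halves]
  have "f t = (\<Sum>\<^sub>\<infinity>k\<in>{..<0}. fourier_coeff f k * t powi k) + (\<Sum>\<^sub>\<infinity>k\<in>{0..}. fourier_coeff f k * t powi k)" .
  then show ?thesis
    by (simp add: wh_plus_eq[OF f t] wh_minus_eq[OF f t] exp_add)
qed

section \<open>Toeplitz and Hankel operators\<close>

lemma l2_bounded:
  assumes "x \<in> l2"
  obtains X where "0 \<le> X" "\<And>k. norm (x k) \<le> X"
proof
  have sum: "summable (\<lambda>j. (norm (x j))\<^sup>2)"
    using assms by (simp add: l2_def)
  show "0 \<le> l2_norm x"
    by (simp add: l2_norm_def suminf_nonneg sum)
  have "(norm (x k))\<^sup>2 \<le> (\<Sum>j. (norm (x j))\<^sup>2)" for k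
    using sum_le_suminf[OF sum, of "{k}"] by simp
  then show "norm (x k) \<le> l2_norm x" for k
    unfolding l2_norm_def by (rule real_le_rsqrt)
qed

lemma l2_norm_nonneg: "x \<in> l2 \<Longrightarrow> 0 \<le> l2_norm x"
  by (simp add: l2_norm_def l2_def suminf_nonneg)

lemma l2_norm_square: "x \<in> l2 \<Longrightarrow> (l2_norm x)\<^sup>2 = (\<Sum>j. (norm (x j))\<^sup>2)"
  by (simp add: l2_norm_def l2_def suminf_nonneg)

lemma l2I_bound:
  assumes "\<And>J. (\<Sum>j<J. (norm (y j))\<^sup>2) \<le> M\<^sup>2" "0 \<le> M"
  shows "y \<in> l2" and "l2_norm y \<le> M"
proof -
  have sum: "summable (\<lambda>j. (norm (y j))\<^sup>2)"
    by (rule summableI_nonneg_bounded[OF _ assms(1)]) simp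
  then show "y \<in> l2"
    by (simp add: l2_def)
  have "(\<Sum>j. (norm (y j))\<^sup>2) \<le> M\<^sup>2"
    by (rule suminf_le_const[OF sum assms(1)])
  then show "l2_norm y \<le> M"
    unfolding l2_norm_def using assms(2) by (rule real_le_lsqrt[rotated 1]) 
qed

lemma l2_partial_sum_le: "x \<in> l2 \<Longrightarrow> (\<Sum>j<J. (norm (x j))\<^sup>2) \<le> (l2_norm x)\<^sup>2"
  by (simp add: l2_norm_square) (auto simp: l2_def intro!: sum_le_suminf)

lemma l2_unit: "(\<lambda>l. if l = k then 1 else 0) \<in> l2"
  unfolding l2_def by (auto intro!: summable_finite[of "{k}"] split: if_splits)

lemma bounded_opI:
  assumes "\<And>x. x \<in> l2 \<Longrightarrow> A x \<in> l2"
    and "\<And>x y. x \<in> l2 \<Longrightarrow> y \<in> l2 \<Longrightarrow> A (\<lambda>j. x j + y j) = (\<lambda>j. A x j + A y j)"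
    and "\<And>z x. x \<in> l2 \<Longrightarrow> A (\<lambda>j. z * x j) = (\<lambda>j. z * A x j)"
    and "\<And>x. x \<in> l2 \<Longrightarrow> l2_norm (A x) \<le> K * l2_norm x"
  shows "bounded_op A"
  unfolding bounded_op_def using assms by blast

lemma bounded_op_l2: "bounded_op A \<Longrightarrow> x \<in> l2 \<Longrightarrow> A x \<in> l2"
  and bounded_op_add: "bounded_op A \<Longrightarrow> x \<in> l2 \<Longrightarrow> y \<in> l2 \<Longrightarrow> A (\<lambda>j. x j + y j) = (\<lambda>j. A x j + A y j)"
  and bounded_op_scale: "bounded_op A \<Longrightarrow> x \<in> l2 \<Longrightarrow> A (\<lambda>j. z * x j) = (\<lambda>j. z * A x j)"
  unfolding bounded_op_def by blast+

lemma bounded_op_bound: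
  assumes "bounded_op A"
  shows "\<exists>K\<ge>0. \<forall>x\<in>l2. l2_norm (A x) \<le> K * l2_norm x"
proof -
  from assms obtain K where K: "\<And>x. x \<in> l2 \<Longrightarrow> l2_norm (A x) \<le> K * l2_norm x"
    unfolding bounded_op_def by blast
  have "l2_norm (A x) \<le> max K 0 * l2_norm x" if "x \<in> l2" for x
    using K[OF that] mult_right_mono[of K "max K 0" "l2_norm x"] l2_norm_nonneg[OF that] by simp
  then show ?thesis
    by (intro exI[of _ "max K 0"]) simp
qed

lemma bounded_op_id: "bounded_op (\<lambda>x. x)"
  by (rule bounded_opI[where K = 1]) auto

lemma bounded_op_comp:
  assumes A: "bounded_op A" and B: "bounded_op B"
  shows "bounded_op (\<lambda>x. A (B x))"
proof -
  obtain K where K: "0 \<le> K" "\<And>x. x \<in> l2 \<Longrightarrow> l2_norm (A x) \<le> K * l2_norm x"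
    using bounded_op_bound[OF A] by blast
  obtain L where L: "0 \<le> L" "\<And>x. x \<in> l2 \<Longrightarrow> l2_norm (B x) \<le> L * l2_norm x"
    using bounded_op_bound[OF B] by blast
  show ?thesis
  proof (rule bounded_opI[where K = "K * L"])
    fix x assume x: "x \<in> l2"
    show "l2_norm (A (B x)) \<le> K * L * l2_norm x"
      using K(2)[OF bounded_op_l2[OF B x]] mult_left_mono[OF L(2)[OF x] K(1)] by (simp add: mult.assoc)
  qed (simp_all add: bounded_op_l2[OF A] bounded_op_l2[OF B] bounded_op_add[OF A] bounded_op_add[OF B]
      bounded_op_scale[OF A] bounded_op_scale[OF B])
qed

lemma bounded_op_lincomb:
  assumes A: "bounded_op A" and B: "bounded_op B"
  shows "bounded_op (\<lambda>x j. A x j + c * B x j)"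
proof -
  obtain K where K: "0 \<le> K" "\<And>x. x \<in> l2 \<Longrightarrow> l2_norm (A x) \<le> K * l2_norm x"
    using bounded_op_bound[OF A] by blast
  obtain L where L: "0 \<le> L" "\<And>x. x \<in> l2 \<Longrightarrow> l2_norm (B x) \<le> L * l2_norm x"
    using bounded_op_bound[OF B] by blast
  \<comment> \<open>A generous constant: the pointwise bound (u + v)^2 \<le> 2 u^2 + 2 v^2 replaces
    Minkowski's inequality and costs only a constant factor.\<close>
  let ?M = "2 * (K + norm c * L)"
  have M: "0 \<le> ?M" using K(1) L(1) by simp
  have est: "(\<Sum>j<J. (norm (A x j + c * B x j))\<^sup>2) \<le> (?M * l2_norm x)\<^sup>2" if x: "x \<in> l2" for x J
  proof -
    note Ax = bounded_op_l2[OF A x] and Bx = bounded_op_l2[OF B x]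
    have nn: "0 \<le> l2_norm x" "0 \<le> l2_norm (A x)" "0 \<le> l2_norm (B x)"
      using l2_norm_nonneg x Ax Bx by blast+
    have pt: "(norm (a + c * b))\<^sup>2 \<le> 2 * (norm a)\<^sup>2 + 2 * (norm c)\<^sup>2 * (norm b)\<^sup>2" for a b :: complex
    proof -
      have "(norm (a + c * b))\<^sup>2 \<le> (norm a + norm c * norm b)\<^sup>2"
        using norm_triangle_ineq[of a "c * b"] by (intro power_mono) (auto simp: norm_mult)
      also have "\<dots> \<le> 2 * (norm a)\<^sup>2 + 2 * (norm c)\<^sup>2 * (norm b)\<^sup>2"
        using zero_le_power2[of "norm a - norm c * norm b"] by (simp add: power2_eq_square algebra_simps)
      finally show ?thesis .
    qed
    have "(\<Sum>j<J. (norm (A x j + c * B x j))\<^sup>2)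
        \<le> (\<Sum>j<J. 2 * (norm (A x j))\<^sup>2 + 2 * (norm c)\<^sup>2 * (norm (B x j))\<^sup>2)"
      by (intro sum_mono pt)
    also have "\<dots> = 2 * (\<Sum>j<J. (norm (A x j))\<^sup>2) + 2 * (norm c)\<^sup>2 * (\<Sum>j<J. (norm (B x j))\<^sup>2)"
      by (simp add: sum.distrib sum_distrib_left)
    also have "\<dots> \<le> 2 * (l2_norm (A x))\<^sup>2 + 2 * (norm c)\<^sup>2 * (l2_norm (B x))\<^sup>2"
      by (intro add_mono mult_left_mono l2_partial_sum_le Ax Bx) auto
    also have "\<dots> \<le> 2 * (K * l2_norm x)\<^sup>2 + 2 * (norm c)\<^sup>2 * (L * l2_norm x)\<^sup>2"
      using K(2)[OF x] L(2)[OF x] nn by (intro add_mono mult_left_mono power_mono) auto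
    also have "\<dots> \<le> (?M * l2_norm x)\<^sup>2"
    proof -
      have "0 \<le> (K * l2_norm x) * (norm c * (L * l2_norm x))"
        using K(1) L(1) nn by (intro mult_nonneg_nonneg) auto
      moreover have "(?M * l2_norm x)\<^sup>2 = 4 * (K * l2_norm x)\<^sup>2 + 4 * (norm c)\<^sup>2 * (L * l2_norm x)\<^sup>2
          + 8 * ((K * l2_norm x) * (norm c * (L * l2_norm x)))"
        by (simp add: power2_eq_square algebra_simps)
      moreover have "0 \<le> (K * l2_norm x)\<^sup>2" "0 \<le> (norm c)\<^sup>2 * (L * l2_norm x)\<^sup>2"
        by simp_all
      ultimately show ?thesis by linarith
    qed
    finally show ?thesis .
  qed
  show ?thesis
  proof (rule bounded_opI[where K = ?M])
    fix x assume x: "x \<in> l2"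
    have "0 \<le> ?M * l2_norm x"
      using M l2_norm_nonneg[OF x] by (rule mult_nonneg_nonneg)
    from l2I_bound[OF est[OF x] this]
    show "(\<lambda>j. A x j + c * B x j) \<in> l2" "l2_norm (\<lambda>j. A x j + c * B x j) \<le> ?M * l2_norm x" .
  qed (simp_all add: bounded_op_add[OF A] bounded_op_add[OF B] bounded_op_scale[OF A] bounded_op_scale[OF B]
      algebra_simps)
qed

lemma bounded_op_sum: "bounded_op A \<Longrightarrow> bounded_op B \<Longrightarrow> bounded_op (\<lambda>x j. A x j + B x j)"
  and bounded_op_diff: "bounded_op A \<Longrightarrow> bounded_op B \<Longrightarrow> bounded_op (\<lambda>x j. A x j - B x j)"
  using bounded_op_lincomb[of A B 1] bounded_op_lincomb[of A B "-1"] by simp_all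

lemma bounded_op_id_minus: "bounded_op A \<Longrightarrow> bounded_op (id_minus A)"
  unfolding id_minus_def[abs_def] by (intro bounded_op_diff bounded_op_id)

lemma bounded_op_P: "bounded_op (proj_P n)"
proof (rule bounded_opI[where K = 1])
  fix x assume x: "x \<in> l2"
  have "(\<Sum>j<J. (norm (proj_P n x j))\<^sup>2) \<le> (l2_norm x)\<^sup>2" for J
    by (rule order_trans[OF sum_mono l2_partial_sum_le[OF x]]) (simp add: proj_P_def)
  from l2I_bound[OF this l2_norm_nonneg[OF x]]
  show "proj_P n x \<in> l2" "l2_norm (proj_P n x) \<le> 1 * l2_norm x" by simp_all
qed (auto simp: proj_P_def)

lemma bounded_op_Q: "bounded_op (proj_Q n)"
  unfolding proj_Q_def by (intro bounded_op_id_minus bounded_op_P)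

lemma proj_Q_apply: "proj_Q n x = (\<lambda>j. if j < n then 0 else x j)"
  by (auto simp: proj_Q_def id_minus_def proj_P_def)

section \<open>Boundedness of Toeplitz and Hankel operators\<close>

definition mat_op :: "(nat \<Rightarrow> nat \<Rightarrow> complex) \<Rightarrow> cseq \<Rightarrow> cseq" where
  "mat_op m x = (\<lambda>j. \<Sum>k. m j k * x k)"

text \<open>Schur's test. Splitting each modulus into two square roots, Cauchy-Schwarz along a row
  costs the row bound \<open>R\<close>; summing over the rows costs the column bound
  \<open>C\<close>, so the norm is at most \<open>sqrt (R * C)\<close>. Bounds on finite partial
  sums suffice as input.\<close>

lemma schur_test:
  assumes R: "\<And>j K. (\<Sum>k<K. norm (m j k)) \<le> R" and C: "\<And>k J. (\<Sum>j<J. norm (m j k)) \<le> C"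
  shows "bounded_op (mat_op m)"
proof -
  have R0: "0 \<le> R" and C0: "0 \<le> C"
    using R[of 0 0] C[of 0 0] by simp_all
  have rows: "summable (\<lambda>k. norm (m j k))" for j
    by (rule summableI_nonneg_bounded[OF _ R]) simp
  have entry: "norm (m j k) \<le> R" for j k
    using order_trans[OF member_le_sum[of k "{..<Suc k}" "\<lambda>k. norm (m j k)"] R] by simp
  have abs: "summable (\<lambda>k. norm (m j k * x k))" if x: "x \<in> l2" for j x
  proof -
    obtain X where "\<And>k. norm (x k) \<le> X"
      using l2_bounded[OF x] by blast
    then show ?thesis
      using summable_mult2[OF rows, of j X]
      by (rule_tac summable_comparison_test'[where N = 0]) (auto simp: norm_mult intro!: mult_left_mono)
  qed
  have summ: "summable (\<lambda>k. m j k * x k)" if "x \<in> l2" for j x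
    by (rule summable_norm_cancel[OF abs[OF that]])
  have est: "(\<Sum>j<J. (norm (mat_op m x j))\<^sup>2) \<le> (sqrt (R * C) * l2_norm x)\<^sup>2" if x: "x \<in> l2" for x J
  proof -
    have sq: "summable (\<lambda>k. (norm (x k))\<^sup>2)"
      using x by (simp add: l2_def)
    have wsq: "summable (\<lambda>k. norm (m j k) * (norm (x k))\<^sup>2)" for j
      using summable_mult[OF sq, of R]
      by (rule summable_comparison_test'[where N = 0]) (auto intro!: mult_right_mono entry)
    have row: "(norm (mat_op m x j))\<^sup>2 \<le> R * (\<Sum>k. norm (m j k) * (norm (x k))\<^sup>2)" for j
    proof -
      have "norm (mat_op m x j) \<le> (\<Sum>k. norm (m j k * x k))"
        unfolding mat_op_def by (rule summable_norm[OF abs[OF x]])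
      then have "(norm (mat_op m x j))\<^sup>2 \<le> (\<Sum>k. norm (m j k * x k))\<^sup>2"
        by (intro power_mono) auto
      also have "\<dots> \<le> R * (\<Sum>k. norm (m j k) * (norm (x k))\<^sup>2)"
      proof (rule LIMSEQ_le_const2)
        show "(\<lambda>K. (\<Sum>k<K. norm (m j k * x k))\<^sup>2) \<longlonglongrightarrow> (\<Sum>k. norm (m j k * x k))\<^sup>2"
          by (intro tendsto_power summable_LIMSEQ abs x)
        have "(\<Sum>k<K. norm (m j k * x k))\<^sup>2 \<le> R * (\<Sum>k. norm (m j k) * (norm (x k))\<^sup>2)" for K
        proof -
          have "(\<Sum>k<K. norm (m j k * x k))\<^sup>2
              = (\<Sum>k<K. sqrt (norm (m j k)) * (sqrt (norm (m j k)) * norm (x k)))\<^sup>2"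
            by (simp add: norm_mult mult.assoc[symmetric])
          also have "\<dots> \<le> (\<Sum>k<K. (sqrt (norm (m j k)))\<^sup>2) * (\<Sum>k<K. (sqrt (norm (m j k)) * norm (x k))\<^sup>2)"
            by (rule Cauchy_Schwarz_ineq_sum)
          also have "\<dots> = (\<Sum>k<K. norm (m j k)) * (\<Sum>k<K. norm (m j k) * (norm (x k))\<^sup>2)"
            by (simp add: power_mult_distrib)
          also have "\<dots> \<le> R * (\<Sum>k. norm (m j k) * (norm (x k))\<^sup>2)"
            by (intro mult_mono R sum_le_suminf wsq) (auto simp: R0 intro!: sum_nonneg)
          finally show ?thesis .
        qed
        then show "\<exists>N. \<forall>K\<ge>N. (\<Sum>k<K. norm (m j k * x k))\<^sup>2 \<le> R * (\<Sum>k. norm (m j k) * (norm (x k))\<^sup>2)"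
          by blast
      qed
      finally show ?thesis .
    qed
    have "(\<Sum>j<J. (norm (mat_op m x j))\<^sup>2) \<le> (\<Sum>j<J. R * (\<Sum>k. norm (m j k) * (norm (x k))\<^sup>2))"
      by (intro sum_mono row)
    also have "\<dots> = R * (\<Sum>k. \<Sum>j<J. norm (m j k) * (norm (x k))\<^sup>2)"
      by (simp add: suminf_sum wsq flip: sum_distrib_left)
    also have "(\<Sum>k. \<Sum>j<J. norm (m j k) * (norm (x k))\<^sup>2) \<le> (\<Sum>k. C * (norm (x k))\<^sup>2)"
    proof (rule suminf_le)
      show "(\<Sum>j<J. norm (m j k) * (norm (x k))\<^sup>2) \<le> C * (norm (x k))\<^sup>2" for k
        unfolding sum_distrib_right[symmetric] by (intro mult_right_mono C) simp
    qed (intro summable_sum wsq summable_mult sq)+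
    also have "(\<Sum>k. C * (norm (x k))\<^sup>2) = C * (l2_norm x)\<^sup>2"
      by (simp add: suminf_mult sq l2_norm_square x)
    finally show ?thesis
      using R0 C0 by (simp add: power_mult_distrib mult.assoc mult_left_mono)
  qed
  show ?thesis
  proof (rule bounded_opI[where K = "sqrt (R * C)"])
    fix x assume x: "x \<in> l2"
    have "0 \<le> sqrt (R * C) * l2_norm x"
      using R0 C0 l2_norm_nonneg[OF x] by simp
    from l2I_bound[OF est[OF x] this]
    show "mat_op m x \<in> l2" "l2_norm (mat_op m x) \<le> sqrt (R * C) * l2_norm x" .
    show "mat_op m (\<lambda>j. z * x j) = (\<lambda>j. z * mat_op m x j)" for z
      by (simp add: mat_op_def suminf_mult[OF summ[OF x], symmetric] mult.left_commute)
    show "mat_op m (\<lambda>j. x j + y j) = (\<lambda>j. mat_op m x j + mat_op m y j)" if "y \<in> l2" for y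
      by (simp add: mat_op_def suminf_add summ x that distrib_left)
  qed
qed

text \<open>Every row and every column of a Toeplitz or Hankel matrix lists Fourier coefficients
  without repetition, so the l1 norm of all coefficients serves as both bounds of Schur's
  test.\<close>

lemma wiener_sum_le:
  assumes "wiener f" "finite F" "inj_on h F"
  shows "(\<Sum>i\<in>F. norm (fourier_coeff f (h i))) \<le> (\<Sum>\<^sub>\<infinity>k. norm (fourier_coeff f k))"
proof -
  have "(\<Sum>i\<in>F. norm (fourier_coeff f (h i))) = (\<Sum>k\<in>h ` F. norm (fourier_coeff f k))"
    using assms(3) by (simp add: sum.reindex)
  also have "\<dots> \<le> (\<Sum>\<^sub>\<infinity>k. norm (fourier_coeff f k))"
    using assms(2) by (intro finite_sum_le_infsum wiener_summable assms(1)) auto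
  finally show ?thesis .
qed

lemma bounded_op_toeplitz: "wiener f \<Longrightarrow> bounded_op (toeplitz_op f)"
  using schur_test[of "\<lambda>j k. fourier_coeff f (int j - int k)", OF wiener_sum_le wiener_sum_le]
  by (simp add: mat_op_def[abs_def] toeplitz_op_def[abs_def] inj_on_def)

lemma bounded_op_hankel: "wiener f \<Longrightarrow> bounded_op (hankel_op f)"
  using schur_test[of "\<lambda>j k. fourier_coeff f (int j + int k + 1)", OF wiener_sum_le wiener_sum_le]
  by (simp add: mat_op_def[abs_def] hankel_op_def[abs_def] inj_on_def)

lemma wiener_summable_on_mult:
  fixes h :: "nat \<Rightarrow> int"
  assumes "wiener f" "inj h" "x \<in> l2"
  shows "(\<lambda>k. norm (fourier_coeff f (h k) * x k)) summable_on UNIV"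
proof -
  obtain X where X: "0 \<le> X" "\<And>k. norm (x k) \<le> X"
    using l2_bounded[OF assms(3)] by blast
  have "(\<lambda>k. norm (fourier_coeff f k)) summable_on range h"
    by (rule summable_on_subset[OF wiener_summable[OF assms(1)]]) auto
  then have "(\<lambda>k. norm (fourier_coeff f (h k))) summable_on UNIV"
    using summable_on_reindex[OF assms(2), of "\<lambda>k. norm (fourier_coeff f k)"] by (simp add: o_def)
  then have "(\<lambda>k. norm (fourier_coeff f (h k)) * X) summable_on UNIV"
    by (rule summable_on_cmult_left)
  then show ?thesis
    by (rule summable_on_comparison_test) (auto simp: norm_mult intro!: mult_left_mono X)
qed

lemma suminf_eq_infsum:
  fixes g :: "nat \<Rightarrow> complex"
  assumes "(\<lambda>k. norm (g k)) summable_on UNIV"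
  shows "(\<Sum>k. g k) = (\<Sum>\<^sub>\<infinity>k. g k)"
  using sums_unique[OF has_sum_imp_sums[OF has_sum_infsum[OF abs_summable_summable[OF assms]]]] by simp

text \<open>Let the doubly infinite matrix of \<open>g\<close> act on \<open>x\<close> extended by
  zero. The entries of the result with nonnegative index form the Toeplitz image, those with
  negative index, read backwards, the Hankel image. Applying the doubly infinite matrix of
  \<open>f\<close> splits accordingly into the two terms on the left, and by Fubini and the
  convolution formula it gives the symbol of the product.\<close>

lemma toeplitz_op_mult:
  assumes f: "wiener f" and g: "wiener g" and x: "x \<in> l2"
  shows "toeplitz_op f (toeplitz_op g x) j + hankel_op f (hankel_op (tilde g) x) j
    = toeplitz_op (\<lambda>t. f t * g t) x j"
proof -
  \<comment> \<open>The image of \<open>x\<close> under the doubly infinite matrix of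
    \<open>g\<close>, at an arbitrary integer index.\<close>
  define G where "G m = (\<Sum>\<^sub>\<infinity>l::nat. fourier_coeff g (m - int l) * x l)" for m
  let ?\<Phi> = "\<lambda>m l. fourier_coeff f (int j - m) * (fourier_coeff g (m - int l) * x l)"
  obtain X where X: "0 \<le> X" "\<And>k. norm (x k) \<le> X"
    using l2_bounded[OF x] by blast
  have inj: "inj (\<lambda>l. m - int l)" for m
    by (auto simp: inj_on_def)
  note absg = wiener_summable_on_mult[OF g inj x]
  let ?N = "\<Sum>\<^sub>\<infinity>k. norm (fourier_coeff g k)"
  have Gabs: "(\<Sum>\<^sub>\<infinity>l. norm (fourier_coeff g (m - int l) * x l)) \<le> ?N * X" for m
  proof (rule infsum_le_finite_sums[OF absg])
    fix F :: "nat set" assume F: "finite F"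
    have "(\<Sum>l\<in>F. norm (fourier_coeff g (m - int l) * x l)) \<le> (\<Sum>l\<in>F. norm (fourier_coeff g (m - int l))) * X"
      unfolding sum_distrib_right by (intro sum_mono) (simp add: norm_mult mult_left_mono X)
    also have "\<dots> \<le> ?N * X"
      by (intro mult_right_mono wiener_sum_le g F X) (auto simp: inj_on_def)
    finally show "(\<Sum>l\<in>F. norm (fourier_coeff g (m - int l) * x l)) \<le> ?N * X" .
  qed
  have fm: "(\<lambda>m. norm (fourier_coeff f (int j - m))) summable_on UNIV"
    using wiener_summable[OF f]
    by (subst summable_on_reindex_bij_witness[of _ "\<lambda>m. int j - m" "\<lambda>m. int j - m" UNIV "\<lambda>m. norm (fourier_coeff f m)"]) auto
  have rows: "(\<lambda>l. norm (?\<Phi> m l)) summable_on UNIV" for m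
    using summable_on_cmult_right[OF absg, of "norm (fourier_coeff f (int j - m))" m] by (simp add: norm_mult)
  have "(\<lambda>m. \<Sum>\<^sub>\<infinity>l. norm (?\<Phi> m l)) summable_on UNIV"
  proof (rule summable_on_comparison_test[OF summable_on_cmult_left[OF fm, of "?N * X"]])
    fix m
    have "(\<Sum>\<^sub>\<infinity>l. norm (?\<Phi> m l)) = norm (fourier_coeff f (int j - m)) * (\<Sum>\<^sub>\<infinity>l. norm (fourier_coeff g (m - int l) * x l))"
      unfolding norm_mult[of "fourier_coeff f _"] by (rule infsum_cmult_right')
    also have "\<dots> \<le> norm (fourier_coeff f (int j - m)) * (?N * X)"
      by (intro mult_left_mono Gabs) simp
    finally show "(\<Sum>\<^sub>\<infinity>l. norm (?\<Phi> m l)) \<le> norm (fourier_coeff f (int j - m)) * (?N * X)" .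
  qed (simp add: infsum_nonneg)
  from infsum_norm_triangle(1)[OF rows this]
  have "(\<lambda>p. norm (case p of (m, l) \<Rightarrow> ?\<Phi> m l)) summable_on UNIV \<times> UNIV"
    by (simp add: case_prod_unfold)
  then have joint: "(\<lambda>(m, l). ?\<Phi> m l) summable_on UNIV \<times> UNIV"
    by (rule abs_summable_summable)
  let ?h = "\<lambda>m. fourier_coeff f (int j - m) * G m"
  have h_eq: "?h m = (\<Sum>\<^sub>\<infinity>l. ?\<Phi> m l)" for m
    unfolding G_def by (rule infsum_cmult_right'[symmetric])
  have h: "?h summable_on UNIV"
    unfolding h_eq using summable_on_Sigma_banach[OF joint] by simp
  then have hp: "(?h has_sum infsum ?h {0..}) {0..}" and hn: "(?h has_sum infsum ?h {..<0}) {..<0}"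
    by (auto intro!: has_sum_infsum summable_on_subset[OF h])
  have Tg: "toeplitz_op g x k = G (int k)" for k
    unfolding toeplitz_op_def G_def by (rule suminf_eq_infsum[OF absg])
  \<comment> \<open>With indices starting at 0, Hankel entry \<open>k\<close> corresponds to the
    integer index \<open>-k - 1\<close>, so the Hankel image covers precisely the negative
    integers.\<close>
  have Hg: "hankel_op (tilde g) x k = G (- int k - 1)" for k
  proof -
    have "- (int k + int l + 1) = - int k - 1 - int l" for l
      by simp
    then show ?thesis
      using suminf_eq_infsum[OF absg[of "- int k - 1"]] by (simp only: hankel_op_def G_def wiener_tilde(2)[OF g])
  qed
  have "((\<lambda>k. ?h (int k)) has_sum infsum ?h {0..}) UNIV"
    by (subst has_sum_reindex_bij_witness[of _ nat int "{0..}" ?h, OF _ _ _ _ _ refl]) (auto intro: hp)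
  then have 1: "toeplitz_op f (toeplitz_op g x) j = infsum ?h {0..}"
    unfolding toeplitz_op_def[of f] Tg by (rule sums_unique[OF has_sum_imp_sums, symmetric])
  have "((\<lambda>k. ?h (- int k - 1)) has_sum infsum ?h {..<0}) UNIV"
    by (subst has_sum_reindex_bij_witness[of _ "\<lambda>m. nat (- m - 1)" "\<lambda>k. - int k - 1" "{..<0}" ?h, OF _ _ _ _ _ refl])
      (auto intro: hn)
  then have "((\<lambda>k. fourier_coeff f (int j + int k + 1) * G (- int k - 1)) has_sum infsum ?h {..<0}) UNIV"
    by (simp add: algebra_simps)
  then have 2: "hankel_op f (hankel_op (tilde g) x) j = infsum ?h {..<0}"
    unfolding hankel_op_def[of f] Hg by (rule sums_unique[OF has_sum_imp_sums, symmetric])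
  have col: "(\<Sum>\<^sub>\<infinity>m. ?\<Phi> m l) = fourier_coeff (\<lambda>t. f t * g t) (int j - int l) * x l" for l
  proof -
    have "(\<Sum>\<^sub>\<infinity>m. ?\<Phi> m l) = (\<Sum>\<^sub>\<infinity>i. fourier_coeff f i * fourier_coeff g (int j - int l - i) * x l)"
      by (rule infsum_reindex_bij_witness[of _ "\<lambda>m. int j - m" "\<lambda>m. int j - m"]) (auto simp: algebra_simps)
    also have "\<dots> = fourier_coeff (\<lambda>t. f t * g t) (int j - int l) * x l"
      unfolding wiener_mult(2)[OF f g] by (rule infsum_cmult_left')
    finally show ?thesis .
  qed
  have "{0..} \<union> {..<0} = (UNIV :: int set)" "{0..} \<inter> {..<0} = ({} :: int set)"
    by auto
  then have "infsum ?h {0..} + infsum ?h {..<0} = infsum ?h UNIV"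
    using infsumI[OF has_sum_Un_disjoint[OF hp hn]] by (simp only:)
  also have "\<dots> = (\<Sum>\<^sub>\<infinity>l. \<Sum>\<^sub>\<infinity>m. ?\<Phi> m l)"
    unfolding h_eq by (rule infsum_swap_banach[OF joint])
  also have "\<dots> = toeplitz_op (\<lambda>t. f t * g t) x j"
    unfolding toeplitz_op_def col
    by (rule suminf_eq_infsum[OF wiener_summable_on_mult[OF wiener_mult(1)[OF f g] inj x], symmetric])
  finally show ?thesis
    by (simp add: 1 2)
qed

lemma toeplitz_op_cong:
  assumes "\<And>t. t \<in> sphere 0 1 \<Longrightarrow> f t = g t"
  shows "toeplitz_op f = toeplitz_op g"
proof -
  have "fourier_coeff f = fourier_coeff g"
    using assms by (rule fourier_coeff_cong)
  then show ?thesis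
    by (simp add: toeplitz_op_def[abs_def])
qed

lemma toeplitz_op_powi: "toeplitz_op (\<lambda>t. t powi (- int n)) x = (\<lambda>j. x (j + n))"
proof
  fix j
  have "(\<lambda>k. fourier_coeff (\<lambda>t. t powi (- int n)) (int j - int k) * x k)
      = (\<lambda>k. if k = j + n then x k else 0)"
    by (auto simp: fourier_coeff_powi)
  then show "toeplitz_op (\<lambda>t. t powi (- int n)) x j = x (j + n)"
    using sums_unique[OF sums_single[of "j + n" x]] by (simp add: toeplitz_op_def)
qed

lemma toeplitz_op_one: "toeplitz_op (\<lambda>t. 1) x = x"
  using toeplitz_op_powi[of 0 x] by simp

lemma toeplitz_op_powi_mult:
  "toeplitz_op (\<lambda>t. t powi (- int n) * f t) x = (\<lambda>j. toeplitz_op f x (j + n))"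
proof -
  have "int j - int k - - int n = int (j + n) - int k" for j k
    by simp
  then show ?thesis
    by (simp only: toeplitz_op_def fourier_coeff_powi_mult)
qed

lemma toeplitz_op_unit: "toeplitz_op f (\<lambda>l. if l = k then 1 else 0) j = fourier_coeff f (int j - int k)"
proof -
  have "(\<lambda>l. fourier_coeff f (int j - int l) * (if l = k then 1 else 0))
      = (\<lambda>l. if l = k then fourier_coeff f (int j - int l) else 0)"
    by auto
  then show ?thesis
    using sums_unique[OF sums_single[of k "\<lambda>l. fourier_coeff f (int j - int l)"]] by (simp add: toeplitz_op_def)
qed

text \<open>A Hankel matrix contains only coefficients of positive index, so the correction term
  vanishes through its left factor \<open>hankel_op f\<close>.\<close>

lemma toeplitz_op_mult_minus:
  assumes "wiener f" "wiener g" "x \<in> l2" and "\<And>k. k > 0 \<Longrightarrow> fourier_coeff f k = 0"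
  shows "toeplitz_op f (toeplitz_op g x) = toeplitz_op (\<lambda>t. f t * g t) x"
proof
  fix j
  have "hankel_op f y j = 0" for y
    by (simp add: hankel_op_def assms(4))
  then show "toeplitz_op f (toeplitz_op g x) j = toeplitz_op (\<lambda>t. f t * g t) x j"
    using toeplitz_op_mult[OF assms(1-3), of j] by simp
qed

text \<open>Here the correction vanishes through its right factor: the reflection turns the positive
  indices of the Hankel matrix into negative indices of \<open>g\<close>.\<close>

lemma toeplitz_op_mult_plus:
  assumes "wiener f" "wiener g" "x \<in> l2" and "\<And>k. k < 0 \<Longrightarrow> fourier_coeff g k = 0"
  shows "toeplitz_op f (toeplitz_op g x) = toeplitz_op (\<lambda>t. f t * g t) x"
proof
  fix j
  have "hankel_op (tilde g) x = (\<lambda>k. 0)"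
    by (simp add: hankel_op_def wiener_tilde[OF assms(2)] assms(4))
  then have "hankel_op f (hankel_op (tilde g) x) j = 0"
    by (simp add: hankel_op_def)
  then show "toeplitz_op f (toeplitz_op g x) j = toeplitz_op (\<lambda>t. f t * g t) x j"
    using toeplitz_op_mult[OF assms(1-3), of j] by simp
qed

text \<open>Without coefficients of positive index the matrix is upper triangular and preserves
  sequences supported on the first \<open>n\<close> places. \<open>proj_Q_toeplitz_plus\<close> is
  the lower triangular counterpart on the tails.\<close>

lemma proj_P_toeplitz_minus:
  assumes "\<And>k. k > 0 \<Longrightarrow> fourier_coeff f k = 0"
  shows "proj_P n (toeplitz_op f (proj_P n x)) = toeplitz_op f (proj_P n x)"
    and "proj_Q n (toeplitz_op f (proj_P n x)) = (\<lambda>j. 0)"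
proof -
  have zero: "fourier_coeff f (int j - int k) * proj_P n x k = 0" if "\<not> j < n" for j k
    using that assms by (simp add: proj_P_def)
  have "toeplitz_op f (proj_P n x) j = 0" if "\<not> j < n" for j
    unfolding toeplitz_op_def zero[OF that] by simp
  then show "proj_P n (toeplitz_op f (proj_P n x)) = toeplitz_op f (proj_P n x)"
    and "proj_Q n (toeplitz_op f (proj_P n x)) = (\<lambda>j. 0)"
    by (auto simp: proj_P_def proj_Q_apply)
qed

lemma proj_Q_toeplitz_plus:
  assumes "\<And>k. k < 0 \<Longrightarrow> fourier_coeff f k = 0"
  shows "proj_Q n (toeplitz_op f (proj_Q n x)) = toeplitz_op f (proj_Q n x)"
    and "proj_P n (toeplitz_op f (proj_Q n x)) = (\<lambda>j. 0)"
proof -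
  have zero: "fourier_coeff f (int j - int k) * proj_Q n x k = 0" if "j < n" for j k
    using that assms by (simp add: proj_Q_apply)
  have "toeplitz_op f (proj_Q n x) j = 0" if "j < n" for j
    unfolding toeplitz_op_def zero[OF that] by simp
  then show "proj_Q n (toeplitz_op f (proj_Q n x)) = toeplitz_op f (proj_Q n x)"
    and "proj_P n (toeplitz_op f (proj_Q n x)) = (\<lambda>j. 0)"
    by (auto simp: proj_P_def proj_Q_apply)
qed

lemma proj_P_add: "proj_P n (\<lambda>j. x j + y j) = (\<lambda>j. proj_P n x j + proj_P n y j)"
  and proj_Q_add: "proj_Q n (\<lambda>j. x j + y j) = (\<lambda>j. proj_Q n x j + proj_Q n y j)"
  by (auto simp: proj_P_def proj_Q_apply)

lemma proj_P_plus_Q: "proj_P n x j + proj_Q n x j = x j"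
  by (simp add: proj_P_def proj_Q_apply)

lemma invertible_opI:
  assumes "bounded_op A" "bounded_op B" "\<And>x. x \<in> l2 \<Longrightarrow> A (B x) = x" "\<And>x. x \<in> l2 \<Longrightarrow> B (A x) = x"
  shows "invertible_op A"
  using assms unfolding invertible_op_def by blast

text \<open>\<open>inv_into\<close> selects some preimage in \<open>l2\<close>; a two-sided inverse
  makes the operator surjective and injective on \<open>l2\<close>, so the selected preimage is the
  only one.\<close>

lemma inverse_op_apply:
  assumes "invertible_op A" "x \<in> l2"
  shows "inverse_op A x \<in> l2" and "A (inverse_op A x) = x" and "inverse_op A (A x) = x"
proof -
  obtain B where B: "bounded_op B" "\<And>x. x \<in> l2 \<Longrightarrow> A (B x) = x" "\<And>x. x \<in> l2 \<Longrightarrow> B (A x) = x"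
    using assms(1) unfolding invertible_op_def by blast
  have "x \<in> A ` l2"
    using B(1,2) assms(2) by (intro image_eqI[of _ _ "B x"]) (simp_all add: bounded_op_l2)
  then show "inverse_op A x \<in> l2" and "A (inverse_op A x) = x"
    unfolding inverse_op_def by (rule inv_into_into, rule f_inv_into_f)
  have "inj_on A l2"
    by (rule inj_on_inverseI[of _ B]) (rule B(3))
  then show "inverse_op A (A x) = x"
    unfolding inverse_op_def using assms(2) by (rule inv_into_f_f)
qed

text \<open>Extends a finite matrix by zero to sequences, so that the inverse of a finite Toeplitz
  matrix can be composed with infinite operators. It reads only the first \<open>n\<close> entries
  of its argument.\<close>

definition finite_mat_op :: "nat \<Rightarrow> complex mat \<Rightarrow> cseq \<Rightarrow> cseq" where
  "finite_mat_op n X x = (\<lambda>j. if j < n then \<Sum>k<n. X $$ (j, k) * x k else 0)"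

lemma bounded_op_finite_mat_op: "bounded_op (finite_mat_op n X)"
proof -
  define m where "m j k = (if j < n \<and> k < n then X $$ (j, k) else 0)" for j k
  have eq: "finite_mat_op n X = mat_op m"
  proof (intro ext)
    fix x j
    have "(\<Sum>k. m j k * x k) = (\<Sum>k<n. m j k * x k)"
      by (rule suminf_finite) (auto simp: m_def)
    then show "finite_mat_op n X x j = mat_op m x j"
      by (auto simp: finite_mat_op_def mat_op_def m_def)
  qed
  define S where "S = (\<Sum>j<n. \<Sum>k<n. norm (m j k))"
  have trim: "(\<Sum>i<K. norm (g i)) \<le> (\<Sum>i<n. norm (g i))" if "\<And>i. \<not> i < n \<Longrightarrow> g i = 0" for g :: "nat \<Rightarrow> complex" and K
  proof -
    have "(\<Sum>i<K. norm (g i)) = (\<Sum>i\<in>{..<K} \<inter> {..<n}. norm (g i))"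
      by (rule sum.mono_neutral_right) (use that in auto)
    also have "\<dots> \<le> (\<Sum>i<n. norm (g i))"
      by (rule sum_mono2) auto
    finally show ?thesis .
  qed
  have row: "(\<Sum>k<n. norm (m j k)) \<le> S" for j
  proof (cases "j < n")
    case True
    then show ?thesis
      unfolding S_def using member_le_sum[of j "{..<n}" "\<lambda>j. \<Sum>k<n. norm (m j k)"] by (simp add: sum_nonneg)
  next
    case False
    then show ?thesis by (simp add: m_def S_def sum_nonneg)
  qed
  have col: "(\<Sum>j<n. norm (m j k)) \<le> S" for k
  proof (cases "k < n")
    case True
    then show ?thesis
      unfolding S_def using member_le_sum[of k "{..<n}" "\<lambda>k. norm (m _ k)"] by (intro sum_mono) simp
  next
    case False
    then show ?thesis by (simp add: m_def S_def sum_nonneg)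
  qed
  show ?thesis
    unfolding eq
  proof (rule schur_test)
    show "(\<Sum>k<K. norm (m j k)) \<le> S" for j K
      by (rule order_trans[OF trim row]) (simp add: m_def)
    show "(\<Sum>j<J. norm (m j k)) \<le> S" for k J
      by (rule order_trans[OF trim col]) (simp add: m_def)
  qed
qed

lemma toeplitz_op_finite_support:
  assumes "\<And>k. \<not> k < n \<Longrightarrow> x k = 0"
  shows "toeplitz_op f x j = (\<Sum>k<n. fourier_coeff f (int j - int k) * x k)"
  unfolding toeplitz_op_def by (rule suminf_finite) (use assms in auto)

text \<open>The restriction to \<open>j < n\<close> is essential: in later rows the infinite
  Toeplitz operator generally produces further nonzero entries, which the operator \<open>S'\<close>
  below subtracts.\<close>

lemma toeplitz_mat_right_inverse:
  assumes X: "X \<in> carrier_mat n n" and inv: "toeplitz_mat n f * X = 1\<^sub>m n" and j: "j < n"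
  shows "toeplitz_op f (finite_mat_op n X y) j = y j"
proof -
  have entry: "(\<Sum>k<n. fourier_coeff f (int j - int k) * X $$ (k, l)) = (if j = l then 1 else 0)" if "l < n" for l
    using arg_cong[OF inv, of "\<lambda>A. A $$ (j, l)"] j that X
    by (simp add: toeplitz_mat_def scalar_prod_def lessThan_atLeast0)
  have "toeplitz_op f (finite_mat_op n X y) j = (\<Sum>k<n. fourier_coeff f (int j - int k) * (\<Sum>l<n. X $$ (k, l) * y l))"
    by (subst toeplitz_op_finite_support[where n = n]) (auto simp: finite_mat_op_def)
  also have "\<dots> = (\<Sum>l<n. (\<Sum>k<n. fourier_coeff f (int j - int k) * X $$ (k, l)) * y l)"
    by (simp add: sum_distrib_left sum_distrib_right mult.assoc) (rule sum.swap)
  also have "\<dots> = (\<Sum>l<n. if j = l then y l else 0)"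
    by (rule sum.cong) (auto simp: entry)
  also have "\<dots> = y j"
    using j by simp
  finally show ?thesis .
qed

lemma toeplitz_mat_left_inverse:
  assumes X: "X \<in> carrier_mat n n" and inv: "X * toeplitz_mat n f = 1\<^sub>m n"
  shows "finite_mat_op n X (toeplitz_op f (proj_P n x)) = proj_P n x"
proof
  fix j
  show "finite_mat_op n X (toeplitz_op f (proj_P n x)) j = proj_P n x j"
  proof (cases "j < n")
    case True
    have entry: "(\<Sum>k<n. X $$ (j, k) * fourier_coeff f (int k - int l)) = (if j = l then 1 else 0)" if "l < n" for l
      using arg_cong[OF inv, of "\<lambda>A. A $$ (j, l)"] True that X
      by (simp add: toeplitz_mat_def scalar_prod_def lessThan_atLeast0)
    have "toeplitz_op f (proj_P n x) k = (\<Sum>l<n. fourier_coeff f (int k - int l) * x l)" for k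
      by (subst toeplitz_op_finite_support[where n = n]) (auto simp: proj_P_def)
    then have "finite_mat_op n X (toeplitz_op f (proj_P n x)) j
        = (\<Sum>k<n. X $$ (j, k) * (\<Sum>l<n. fourier_coeff f (int k - int l) * x l))"
      using True by (simp add: finite_mat_op_def)
    also have "\<dots> = (\<Sum>l<n. (\<Sum>k<n. X $$ (j, k) * fourier_coeff f (int k - int l)) * x l)"
      by (simp add: sum_distrib_left sum_distrib_right mult.assoc) (rule sum.swap)
    also have "\<dots> = (\<Sum>l<n. if j = l then x l else 0)"
      by (rule sum.cong) (auto simp: entry)
    also have "\<dots> = proj_P n x j"
      using True by (simp add: proj_P_def)
    finally show ?thesis .
  qed (simp add: finite_mat_op_def proj_P_def)
qed

section \<open>Inversion by Wiener-Hopf factorization\<close>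

text \<open>The functions \<open>m\<close> and \<open>p\<close> stand for a_- and a_+, and
  \<open>X\<close> for the inverse of the Toeplitz matrix of order \<open>N\<close>. The algebra
  needs the factors only through their one-sided coefficients, without any reference to
  logarithms.\<close>

locale wiener_hopf =
  fixes m p :: "complex \<Rightarrow> complex" and N :: nat and X :: "complex mat"
  assumes m: "wiener m" "wiener (\<lambda>t. inverse (m t))"
    and p: "wiener p" "wiener (\<lambda>t. inverse (p t))"
    and m_minus: "\<And>k. k > 0 \<Longrightarrow> fourier_coeff m k = 0" "\<And>k. k > 0 \<Longrightarrow> fourier_coeff (\<lambda>t. inverse (m t)) k = 0"
    and p_plus: "\<And>k. k < 0 \<Longrightarrow> fourier_coeff p k = 0" "\<And>k. k < 0 \<Longrightarrow> fourier_coeff (\<lambda>t. inverse (p t)) k = 0"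
    and nz: "\<And>t. t \<in> sphere 0 1 \<Longrightarrow> m t \<noteq> 0" "\<And>t. t \<in> sphere 0 1 \<Longrightarrow> p t \<noteq> 0"
    and X: "X \<in> carrier_mat N N" "toeplitz_mat N (\<lambda>t. m t * p t) * X = 1\<^sub>m N"
      "X * toeplitz_mat N (\<lambda>t. m t * p t) = 1\<^sub>m N"
begin

definition "Ta = toeplitz_op (\<lambda>t. m t * p t)"
definition "Tm = toeplitz_op m"
definition "Tm' = toeplitz_op (\<lambda>t. inverse (m t))"
definition "Tp = toeplitz_op p"
definition "Tp' = toeplitz_op (\<lambda>t. inverse (p t))"
definition "b t = m t * inverse (p t)"
definition "c t = p t * inverse (m t)"
definition "A = id_minus (hankel_op b \<circ> hankel_op (tilde c) \<circ> proj_Q N)"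
definition "J x = Ta (Tm' x)"
definition "J' x = Tm (Tp' (Tm' x))"
text \<open>The block diagonal right factor of J A: the first summand stays in the range of
  \<open>proj_P N\<close>, the second in that of \<open>proj_Q N\<close>. Its inverse
  \<open>D'\<close> inverts each block separately.\<close>

definition "D x = (\<lambda>j. Tm' (proj_P N x) j + Tp (proj_Q N x) j)"
definition "D' x = (\<lambda>j. Tm (proj_P N x) j + Tp' (proj_Q N x) j)"
definition "S x = (\<lambda>j. Ta (proj_P N x) j + proj_Q N x j)"
text \<open>Block substitution for \<open>S\<close>: the first \<open>N\<close> equations determine
  the head through \<open>X\<close>, and the tail is what remains of \<open>x\<close> after
  subtracting the contribution of that head.\<close>

definition "S' x = (\<lambda>j. finite_mat_op N X x j + proj_Q N (\<lambda>i. x i - Ta (finite_mat_op N X x) i) j)"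

lemma wiener_bc: "wiener b" "wiener c"
  unfolding b_def[abs_def] c_def[abs_def] by (intro wiener_mult m p)+

lemma bounded: "bounded_op Ta" "bounded_op Tm" "bounded_op Tm'" "bounded_op Tp" "bounded_op Tp'"
  unfolding Ta_def Tm_def Tm'_def Tp_def Tp'_def by (intro bounded_op_toeplitz wiener_mult m p)+

lemmas in_l2 = bounded[THEN bounded_op_l2] bounded_op_l2[OF bounded_op_P] bounded_op_l2[OF bounded_op_Q]

lemma inverses:
  assumes "x \<in> l2"
  shows "Tm (Tm' x) = x" "Tm' (Tm x) = x" "Tp (Tp' x) = x" "Tp' (Tp x) = x"
proof -
  have one: "toeplitz_op (\<lambda>t. f t) x = x" if "\<And>t. t \<in> sphere 0 1 \<Longrightarrow> f t = 1" for f
    using toeplitz_op_cong[of f "\<lambda>_. 1"] that by (simp add: toeplitz_op_one)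
  show "Tm (Tm' x) = x" "Tm' (Tm x) = x"
    unfolding Tm_def Tm'_def using m m_minus assms nz
    by (subst toeplitz_op_mult_minus; auto intro!: one)+
  show "Tp (Tp' x) = x" "Tp' (Tp x) = x"
    unfolding Tp_def Tp'_def using p p_plus assms nz
    by (subst toeplitz_op_mult_plus; auto intro!: one)+
qed

lemma Ta_eq: "x \<in> l2 \<Longrightarrow> Ta x = Tm (Tp x)"
  unfolding Ta_def Tm_def Tp_def using m p m_minus by (simp add: toeplitz_op_mult_minus)

lemma Tb_eq: "x \<in> l2 \<Longrightarrow> toeplitz_op b x = Tm (Tp' x)"
  unfolding b_def[abs_def] Tm_def Tp'_def using m p m_minus by (simp add: toeplitz_op_mult_minus)

lemma Tc_eq:
  assumes "x \<in> l2"
  shows "toeplitz_op c x = Tm' (Tp x)"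
proof -
  have "toeplitz_op c x = toeplitz_op (\<lambda>t. inverse (m t) * p t) x"
    by (simp add: c_def[abs_def] mult.commute)
  then show ?thesis
    unfolding Tm'_def Tp_def using m p m_minus assms by (simp add: toeplitz_op_mult_minus)
qed

text \<open>Since \<open>b\<close> and \<open>c\<close> are reciprocal on the circle, the product
  formula reads T(b)T(c) = I minus the product of the two Hankel operators; it is applied to the
  tail of \<open>x\<close>.\<close>

lemma A_eq:
  assumes x: "x \<in> l2"
  shows "A x = (\<lambda>j. proj_P N x j + toeplitz_op b (toeplitz_op c (proj_Q N x)) j)"
proof
  fix j
  let ?y = "proj_Q N x"
  have "b t * c t = 1" if "t \<in> sphere 0 1" for t
    using nz[OF that] by (simp add: b_def c_def field_simps)
  then have "toeplitz_op (\<lambda>t. b t * c t) = toeplitz_op (\<lambda>t. 1)"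
    by (rule toeplitz_op_cong)
  then have "toeplitz_op (\<lambda>t. b t * c t) ?y = ?y"
    by (simp only: toeplitz_op_one)
  then have "toeplitz_op b (toeplitz_op c ?y) j + hankel_op b (hankel_op (tilde c) ?y) j = ?y j"
    using toeplitz_op_mult[OF wiener_bc, of ?y j] in_l2(7)[OF x] by simp
  then have "hankel_op b (hankel_op (tilde c) ?y) j = ?y j - toeplitz_op b (toeplitz_op c ?y) j"
    by (simp add: algebra_simps)
  then show "A x j = proj_P N x j + toeplitz_op b (toeplitz_op c ?y) j"
    using proj_P_plus_Q[of N x j] by (simp add: A_def id_minus_def algebra_simps)
qed

lemma bounded_JDS:
  shows "bounded_op J" and "bounded_op D'" and "bounded_op S'"
proof -
  note comp = bounded_op_comp
  show "bounded_op J"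
    unfolding J_def[abs_def] by (rule comp[OF bounded(1,3)])
  show "bounded_op D'"
    unfolding D'_def[abs_def]
    by (rule bounded_op_sum[OF comp[OF bounded(2) bounded_op_P] comp[OF bounded(5) bounded_op_Q]])
  show "bounded_op S'"
    unfolding S'_def[abs_def]
    by (rule bounded_op_sum[OF bounded_op_finite_mat_op
        comp[OF bounded_op_Q bounded_op_diff[OF bounded_op_id comp[OF bounded(1) bounded_op_finite_mat_op]]]])
qed

lemma J_inverse: "x \<in> l2 \<Longrightarrow> J' (J x) = x"
  by (simp add: J_def J'_def Ta_eq inverses in_l2)

lemma J_Tb: "x \<in> l2 \<Longrightarrow> J (toeplitz_op b x) = Tm x"
  by (simp add: J_def Tb_eq Ta_eq inverses in_l2)

lemma JA_eq:
  assumes x: "x \<in> l2"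
  shows "J (A x) = S (D x)"
proof -
  let ?y = "toeplitz_op b (toeplitz_op c (proj_Q N x))"
  have y: "?y = Tm (Tp' (Tm' (Tp (proj_Q N x))))"
    using x by (simp add: Tb_eq Tc_eq in_l2)
  have "J ?y = Tp (proj_Q N x)"
    using x by (simp add: Tc_eq J_Tb inverses in_l2)
  then have "J (A x) = (\<lambda>j. J (proj_P N x) j + Tp (proj_Q N x) j)"
    using x bounded_op_add[OF bounded_JDS(1), of "proj_P N x" ?y] by (simp add: A_eq y in_l2)
  moreover have "proj_P N (D x) = Tm' (proj_P N x)" "proj_Q N (D x) = Tp (proj_Q N x)"
    unfolding D_def Tm'_def Tp_def
    by (simp_all add: proj_P_add proj_Q_add proj_P_toeplitz_minus m_minus proj_Q_toeplitz_plus p_plus)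
  ultimately show ?thesis
    by (simp add: S_def J_def)
qed

lemma D_D':
  assumes x: "x \<in> l2"
  shows "D (D' x) = x" "D' (D x) = x" "proj_P N (D x) = Tm' (proj_P N x)"
proof -
  have P: "proj_P N (D' x) = Tm (proj_P N x)" "proj_Q N (D' x) = Tp' (proj_Q N x)"
    unfolding D'_def Tm_def Tp'_def
    by (simp_all add: proj_P_add proj_Q_add proj_P_toeplitz_minus m_minus proj_Q_toeplitz_plus p_plus)
  have Q: "proj_P N (D x) = Tm' (proj_P N x)" "proj_Q N (D x) = Tp (proj_Q N x)"
    unfolding D_def Tm'_def Tp_def
    by (simp_all add: proj_P_add proj_Q_add proj_P_toeplitz_minus m_minus proj_Q_toeplitz_plus p_plus)
  show "proj_P N (D x) = Tm' (proj_P N x)" by (rule Q)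
  show "D (D' x) = x"
    using x by (simp add: D_def[of "D' x"] P inverses in_l2 proj_P_plus_Q)
  show "D' (D x) = x"
    using x by (simp add: D'_def[of "D x"] Q inverses in_l2 proj_P_plus_Q)
qed

lemma PS': "proj_P N (S' x) = finite_mat_op N X x"
  by (auto simp: S'_def proj_P_def proj_Q_apply finite_mat_op_def)

text \<open>Valid for arbitrary sequences, because \<open>Ta\<close> is only ever applied to
  finitely supported ones here, for which its series are finite sums.\<close>

lemma S_S': "S (S' x) = x" "S' (S x) = x"
proof -
  have "proj_Q N (S' x) = proj_Q N (\<lambda>i. x i - Ta (finite_mat_op N X x) i)"
    by (auto simp: S'_def proj_Q_apply finite_mat_op_def)
  then have SS: "S (S' x) = (\<lambda>j. Ta (finite_mat_op N X x) j + proj_Q N (\<lambda>i. x i - Ta (finite_mat_op N X x) i) j)"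
    by (simp add: S_def[of "S' x"] PS')
  show "S (S' x) = x"
  proof
    fix j
    show "S (S' x) j = x j"
      unfolding SS using toeplitz_mat_right_inverse[OF X(1,2), of j x] by (simp add: proj_Q_apply Ta_def)
  qed
  have "finite_mat_op N X (S x) = finite_mat_op N X (Ta (proj_P N x))"
    by (auto simp: finite_mat_op_def S_def proj_Q_apply)
  also have "\<dots> = proj_P N x"
    unfolding Ta_def by (rule toeplitz_mat_left_inverse[OF X(1,3)])
  finally have "finite_mat_op N X (S x) = proj_P N x" .
  moreover have "(\<lambda>i. S x i - Ta (proj_P N x) i) = proj_Q N x"
    by (simp add: S_def)
  ultimately have "S' (S x) = (\<lambda>j. proj_P N x j + proj_Q N (proj_Q N x) j)"
    by (simp only: S'_def[of "S x"])
  then show "S' (S x) = x"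
    by (auto simp: proj_P_def proj_Q_apply)
qed

lemma bounded_A: "bounded_op A"
  unfolding A_def o_def
  by (rule bounded_op_id_minus[OF bounded_op_comp[OF bounded_op_hankel[OF wiener_bc(1)]
      bounded_op_comp[OF bounded_op_hankel[OF wiener_tilde(1)[OF wiener_bc(2)]] bounded_op_Q]]])

lemma invertible_A: "invertible_op A"
proof (rule invertible_opI[OF bounded_A])
  show "bounded_op (\<lambda>x. D' (S' (J x)))"
    by (rule bounded_op_comp[OF bounded_JDS(2) bounded_op_comp[OF bounded_JDS(3,1)]])
  fix x assume x: "x \<in> l2"
  have G: "S' (J x) \<in> l2" "D' (S' (J x)) \<in> l2" "J x \<in> l2"
    using x by (simp_all add: bounded_JDS[THEN bounded_op_l2])
  \<comment> \<open>The left inverse \<open>J'\<close> suffices: it makes \<open>J\<close> injective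
    on \<open>l2\<close>, so the equation can be checked after applying \<open>J\<close>, where the
    factorization of J A is available.\<close>
  have "A (D' (S' (J x))) = J' (J (A (D' (S' (J x)))))"
    using G bounded_op_l2[OF bounded_A] by (simp add: J_inverse)
  also have "\<dots> = x"
    using G x by (simp add: JA_eq D_D' S_S' J_inverse)
  finally show "A (D' (S' (J x))) = x" .
  show "D' (S' (J (A x))) = x"
    using x by (simp add: JA_eq S_S' D_D')
qed

text \<open>The formula for P A^{-1} T(b), phrased for a solution \<open>x\<close> of the equation
  and so independent of any choice of inverse. Applying \<open>J\<close> gives
  \<open>S (D x) = Tm y\<close>; the head of \<open>D x\<close> is \<open>Tm' (proj_P N x)\<close>,
  and \<open>Tm\<close> undoes the remaining factor.\<close>

lemma solution_head:
  assumes x: "x \<in> l2" and y: "y \<in> l2" and eq: "A x = toeplitz_op b y"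
  shows "proj_P N x = Tm (finite_mat_op N X (Tm y))"
proof -
  have "D x = S' (S (D x))"
    by (simp add: S_S')
  also have "\<dots> = S' (Tm y)"
    using x y by (simp add: eq J_Tb flip: JA_eq)
  finally have "proj_P N (D x) = finite_mat_op N X (Tm y)"
    by (simp add: PS')
  then have "Tm (Tm' (proj_P N x)) = Tm (finite_mat_op N X (Tm y))"
    using x by (simp add: D_D')
  then show ?thesis
    using x by (simp add: inverses in_l2)
qed

end

section \<open>Conjugation by shifts\<close>

lemma bounded_op_shift_left: "bounded_op (\<lambda>x j. x (j + n))"
proof (rule bounded_opI[where K = 1])
  fix x :: cseq assume x: "x \<in> l2"
  have "(\<Sum>j<J. (norm (x (j + n)))\<^sup>2) \<le> (l2_norm x)\<^sup>2" for J
  proof -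
    have "(\<Sum>j<J. (norm (x (j + n)))\<^sup>2) = (\<Sum>j\<in>{n..<J + n}. (norm (x j))\<^sup>2)"
      by (rule sum.reindex_bij_witness[of _ "\<lambda>j. j - n" "\<lambda>j. j + n"]) auto
    also have "\<dots> \<le> (\<Sum>j<J + n. (norm (x j))\<^sup>2)"
      by (rule sum_mono2) auto
    also have "\<dots> \<le> (l2_norm x)\<^sup>2"
      by (rule l2_partial_sum_le[OF x])
    finally show ?thesis .
  qed
  from l2I_bound[OF this l2_norm_nonneg[OF x]]
  show "(\<lambda>j. x (j + n)) \<in> l2" "l2_norm (\<lambda>j. x (j + n)) \<le> 1 * l2_norm x" by simp_all
qed simp_all

lemma bounded_op_shift_right: "bounded_op (\<lambda>x j. if j < n then 0 else x (j - n))"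
proof (rule bounded_opI[where K = 1])
  fix x :: cseq assume x: "x \<in> l2"
  have "(\<Sum>j<J. (norm (if j < n then 0 else x (j - n)))\<^sup>2) \<le> (l2_norm x)\<^sup>2" for J
  proof -
    have "(\<Sum>j<J. (norm (if j < n then 0 else x (j - n)))\<^sup>2) = (\<Sum>j\<in>{n..<J}. (norm (if j < n then 0 else x (j - n)))\<^sup>2)"
      by (rule sum.mono_neutral_right) auto
    also have "\<dots> = (\<Sum>j<J - n. (norm (x j))\<^sup>2)"
      by (rule sum.reindex_bij_witness[of _ "\<lambda>j. j + n" "\<lambda>j. j - n"]) auto
    also have "\<dots> \<le> (l2_norm x)\<^sup>2"
      by (rule l2_partial_sum_le[OF x])
    finally show ?thesis .
  qed
  from l2I_bound[OF this l2_norm_nonneg[OF x]]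
  show "(\<lambda>j. if j < n then 0 else x (j - n)) \<in> l2" "l2_norm (\<lambda>j. if j < n then 0 else x (j - n)) \<le> 1 * l2_norm x"
    by simp_all
qed auto

text \<open>A Hankel entry depends only on the sum of its two indices, so a shift by
  \<open>n\<close> can be moved from the columns to the rows.\<close>

lemma hankel_op_proj_Q: "hankel_op f (proj_Q n x) j = hankel_op f (\<lambda>k. x (k + n)) (j + n)"
proof -
  let ?g = "\<lambda>k. fourier_coeff f (int j + int k + 1) * proj_Q n x k"
  \<comment> \<open>Comparing the predicates \<open>sums\<close> rather than the values keeps the
    identity valid for every sequence, convergent or not.\<close>
  have "(\<lambda>k. ?g (k + n)) sums s \<longleftrightarrow> ?g sums s" for s
    by (rule sums_zero_iff_shift) (simp add: proj_Q_apply)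
  then have "(\<Sum>k. ?g (k + n)) = (\<Sum>k. ?g k)"
    by (simp only: suminf_def)
  moreover have "int j + int (k + n) + 1 = int (j + n) + int k + 1" for k
    by simp
  moreover have "proj_Q n x (k + n) = x (k + n)" for k
    by (simp add: proj_Q_apply)
  ultimately show ?thesis
    by (simp only: hankel_op_def)
qed

lemma hankel_op_shift_right: "hankel_op f x (j + n) = hankel_op f (\<lambda>k. if k < n then 0 else x (k - n)) j"
  using hankel_op_proj_Q[of f n "\<lambda>k. if k < n then 0 else x (k - n)" j]
  by (simp add: proj_Q_apply cong: if_cong)

text \<open>The shifts satisfy L R = I and R L = Q_n. With U Q_n = U this gives (I - L U R) L = L (I
  - U), and the familiar passage between I - XY and I - YX, for X = L and Y = U R, transfers
  invertibility.\<close>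

lemma shift_conjugate:
  fixes U :: "cseq \<Rightarrow> cseq" and n :: nat
  defines "L \<equiv> \<lambda>x j. x (j + n)" and "R \<equiv> \<lambda>x j. if j < n then 0 else x (j - n)"
  assumes U: "bounded_op U" and UQ: "\<And>x. U (proj_Q n x) = U x" and A: "invertible_op (id_minus U)"
  shows "invertible_op (id_minus (\<lambda>x. L (U (R x))))"
    and "w \<in> l2 \<Longrightarrow> id_minus (\<lambda>x. L (U (R x))) (L w) = L (id_minus U w)"
proof -
  let ?B = "id_minus (\<lambda>x. L (U (R x)))"
  have L: "bounded_op L" and R: "bounded_op R"
    unfolding L_def R_def by (rule bounded_op_shift_left bounded_op_shift_right)+
  have RL: "R (L x) = proj_Q n x" for x
    by (auto simp: R_def L_def proj_Q_apply)
  obtain G where G: "bounded_op G" "\<And>x. x \<in> l2 \<Longrightarrow> id_minus U (G x) = x" "\<And>x. x \<in> l2 \<Longrightarrow> G (id_minus U x) = x"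
    using A unfolding invertible_op_def by blast
  have BL: "?B (L w) = L (id_minus U w)" for w
    by (simp add: id_minus_def RL UQ) (simp add: L_def)
  then show "?B (L w) = L (id_minus U w)" .
  have bU: "bounded_op (\<lambda>x. U (R x))"
    by (rule bounded_op_comp[OF U R])
  have B: "bounded_op ?B"
    by (rule bounded_op_id_minus[OF bounded_op_comp[OF L bU]])
  show "invertible_op ?B"
  proof (rule invertible_opI[OF B])
    \<comment> \<open>The inverse of I - XY is I + X (I - YX)^{-1} Y; here YX = U R L = U, and
      \<open>G\<close> inverts I - U.\<close>
    show "bounded_op (\<lambda>x j. x j + L (G (U (R x))) j)"
      by (rule bounded_op_sum[OF bounded_op_id bounded_op_comp[OF L bounded_op_comp[OF G(1) bU]]])
    fix x assume x: "x \<in> l2"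
    have UR: "U (R x) \<in> l2"
      by (rule bounded_op_l2[OF bU x])
    have LG: "L (G (U (R x))) \<in> l2"
      by (rule bounded_op_l2[OF L bounded_op_l2[OF G(1) UR]])
    have "?B (\<lambda>j. x j + L (G (U (R x))) j) = (\<lambda>j. ?B x j + L (U (R x)) j)"
      by (simp only: bounded_op_add[OF B x LG] BL G(2)[OF UR])
    then show "?B (\<lambda>j. x j + L (G (U (R x))) j) = x"
      by (simp add: id_minus_def)
    have "R (?B x) = (\<lambda>j. R x j - proj_Q n (U (R x)) j)"
      by (auto simp: R_def L_def id_minus_def proj_Q_apply)
    then have "U (R (?B x)) = U (\<lambda>j. R x j + (-1) * proj_Q n (U (R x)) j)"
      by simp
    also have "\<dots> = (\<lambda>j. U (R x) j + (-1) * U (U (R x)) j)"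
    proof -
      have Q: "proj_Q n (U (R x)) \<in> l2"
        by (rule bounded_op_l2[OF bounded_op_Q UR])
      then have "(\<lambda>j. (-1) * proj_Q n (U (R x)) j) \<in> l2"
        by (simp add: l2_def)
      from bounded_op_add[OF U bounded_op_l2[OF R x] this] show ?thesis
        by (simp only: bounded_op_scale[OF U Q] UQ)
    qed
    also have "\<dots> = id_minus U (U (R x))"
      by (simp add: id_minus_def)
    finally have "G (U (R (?B x))) = U (R x)"
      using G(3)[OF UR] by simp
    then show "(\<lambda>j. ?B x j + L (G (U (R (?B x)))) j) = x"
      by (simp add: id_minus_def)
  qed
qed

section \<open>Minors of inverse matrices\<close>

lemma det_unit_upper_toeplitz:
  fixes u :: "int \<Rightarrow> complex"
  assumes "u 0 = 1" "\<And>k. k > 0 \<Longrightarrow> u k = 0"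
  shows "Determinant.det (Matrix.mat k k (\<lambda>(i, j). u (int i - int j))) = 1"
proof -
  let ?A = "Matrix.mat k k (\<lambda>(i, j). u (int i - int j))"
  have "upper_triangular ?A"
    using assms(2) by (auto simp: upper_triangular_def)
  then have "Determinant.det ?A = prod_list (diag_mat ?A)"
    by (rule det_upper_triangular) auto
  also have "diag_mat ?A = map (\<lambda>i. 1) [0..<k]"
    unfolding diag_mat_def by (rule map_cong) (auto simp: assms(1))
  also have "prod_list \<dots> = 1"
    by (induction k) auto
  finally show ?thesis .
qed

text \<open>Jacobi's identity for a corner block. Multiplying \<open>M\<close> by the auxiliary
  matrix \<open>Y\<close> gives a block triangular matrix whose determinant is the minor of
  \<open>M\<close>, while the determinant of \<open>Y\<close> is the minor of \<open>X\<close> up to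
  the sign of a block row exchange. The form as a product avoids division.\<close>

lemma jacobi_corner_minor:
  fixes M X :: "'a :: idom mat"
  assumes M: "M \<in> carrier_mat (n + k) (n + k)" and X: "X \<in> carrier_mat (n + k) (n + k)"
    and MX: "M * X = 1\<^sub>m (n + k)"
  shows "Determinant.det M * Determinant.det (Matrix.mat k k (\<lambda>(i, j). X $$ (n + i, j)))
    = (-1) ^ (n * k) * Determinant.det (Matrix.mat n n (\<lambda>(i, j). M $$ (k + i, j)))"
proof -
  let ?X2 = "Matrix.mat k k (\<lambda>(i, j). X $$ (n + i, j))"
  let ?X1 = "Matrix.mat n k (\<lambda>(i, j). X $$ (i, j))"
  let ?M1 = "Matrix.mat k n (\<lambda>(i, j). M $$ (i, j))"
  let ?M2 = "Matrix.mat n n (\<lambda>(i, j). M $$ (k + i, j))"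
  \<comment> \<open>The first \<open>k\<close> columns of \<open>X\<close> followed by the first
    \<open>n\<close> unit vectors: \<open>M\<close> sends the former to unit vectors and the latter
    to its own first \<open>n\<close> columns.\<close>
  define Y where "Y = Matrix.mat (k + n) (k + n)
    (\<lambda>(i, j). if j < k then X $$ (i, j) else if i = j - k then 1 else 0)"
  have Y: "Y \<in> carrier_mat (k + n) (k + n)"
    by (simp add: Y_def)
  have M': "M \<in> carrier_mat (k + n) (k + n)"
    using M by (simp add: add.commute)
  have "Determinant.det Y = (-1) ^ (k * n) * Determinant.det (Matrix.mat (k + n) (k + n) (\<lambda>(i, j).
      Y $$ ((if i < k then i + n else i - k), j)))"
    by (rule det_swap_rows[OF Y])
  also have "Matrix.mat (k + n) (k + n) (\<lambda>(i, j). Y $$ ((if i < k then i + n else i - k), j))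
      = four_block_mat ?X2 (0\<^sub>m k n) ?X1 (1\<^sub>m n)"
    by (rule eq_matI) (auto simp: Y_def add.commute)
  also have "Determinant.det \<dots> = Determinant.det ?X2"
    by (subst det_four_block_mat_upper_right_zero[where n = k and m = n]) auto
  finally have detY: "Determinant.det Y = (-1) ^ (n * k) * Determinant.det ?X2"
    by (simp add: mult.commute)
  have col: "col Y j = (if j < k then col X j else unit_vec (k + n) (j - k))" if "j < k + n" for j
    using that X by (intro eq_vecI) (auto simp: Y_def)
  have MX': "Matrix.row M i \<bullet> col X j = (if i = j then 1 else 0)" if "i < k + n" "j < k + n" for i j
    using arg_cong[OF MX, of "\<lambda>A. A $$ (i, j)"] that M X by (simp add: add.commute)
  have "M * Y = four_block_mat (1\<^sub>m k) ?M1 (0\<^sub>m n k) ?M2"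
  proof (rule eq_matI)
    fix i j assume "i < dim_row (four_block_mat (1\<^sub>m k) ?M1 (0\<^sub>m n k) ?M2)"
      "j < dim_col (four_block_mat (1\<^sub>m k) ?M1 (0\<^sub>m n k) ?M2)"
    then have ij: "i < k + n" "j < k + n" by auto
    have "(M * Y) $$ (i, j) = Matrix.row M i \<bullet> col Y j"
      using ij M' Y by simp
    then show "(M * Y) $$ (i, j) = four_block_mat (1\<^sub>m k) ?M1 (0\<^sub>m n k) ?M2 $$ (i, j)"
      using ij M' MX' by (auto simp: col scalar_prod_right_unit)
  qed (use M' Y in auto)
  then have detMY: "Determinant.det M * Determinant.det Y = Determinant.det ?M2"
    using det_mult[OF M' Y] det_four_block_mat_lower_left_zero[of "1\<^sub>m k" k ?M1 n "0\<^sub>m n k" ?M2] by simp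
  have "(-1) ^ (n * k) * Determinant.det ?M2
      = ((-1) ^ (n * k) * (-1) ^ (n * k)) * (Determinant.det M * Determinant.det ?X2)"
    by (simp only: detMY[symmetric] detY mult_ac)
  also have "(-1) ^ (n * k) * (-1) ^ (n * k) = (1 :: 'a)"
    by (simp flip: power_mult_distrib)
  finally show ?thesis by simp
qed

text \<open>Triangularity truncates both sums: the rows \<open>i + n\<close> see only
  \<open>l \<ge> n\<close>, and the columns \<open>j < k\<close> see only \<open>m < k\<close>. What
  remains is the lower left block of \<open>X\<close> between two copies of one unipotent
  matrix.\<close>

lemma det_toeplitz_sandwich:
  fixes u :: "int \<Rightarrow> complex"
  assumes u0: "u 0 = 1" and u: "\<And>k. k > 0 \<Longrightarrow> u k = 0"
  shows "Determinant.det (Matrix.mat k k (\<lambda>(i, j). \<Sum>l<n + k. u (int (i + n) - int l) *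
        (\<Sum>m<n + k. X $$ (l, m) * u (int m - int j))))
    = Determinant.det (Matrix.mat k k (\<lambda>(i, j). X $$ (n + i, j)))"
proof -
  let ?U = "Matrix.mat k k (\<lambda>(i, j). u (int i - int j))"
  let ?X2 = "Matrix.mat k k (\<lambda>(i, j). X $$ (n + i, j))"
  have "Matrix.mat k k (\<lambda>(i, j). \<Sum>l<n + k. u (int (i + n) - int l) *
        (\<Sum>m<n + k. X $$ (l, m) * u (int m - int j))) = ?U * (?X2 * ?U)"
  proof (rule eq_matI)
    fix i j assume "i < dim_row (?U * (?X2 * ?U))" "j < dim_col (?U * (?X2 * ?U))"
    then have ij: "i < k" "j < k" by auto
    have inner: "(\<Sum>m<n + k. X $$ (l, m) * u (int m - int j)) = (\<Sum>m<k. X $$ (l, m) * u (int m - int j))" for l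
      by (rule sum.mono_neutral_right) (use ij in \<open>auto simp: u\<close>)
    have "(\<Sum>l<n + k. u (int (i + n) - int l) * g l) = (\<Sum>l<k. u (int i - int l) * g (n + l))" for g
    proof -
      have "(\<Sum>l<n + k. u (int (i + n) - int l) * g l) = (\<Sum>l\<in>{n..<n + k}. u (int (i + n) - int l) * g l)"
        by (rule sum.mono_neutral_right) (auto simp: u)
      also have "\<dots> = (\<Sum>l<k. u (int i - int l) * g (n + l))"
        by (rule sum.reindex_bij_witness[of _ "\<lambda>l. n + l" "\<lambda>l. l - n"]) (auto intro!: arg_cong[of _ _ u])
      finally show ?thesis .
    qed
    then show "Matrix.mat k k (\<lambda>(i, j). \<Sum>l<n + k. u (int (i + n) - int l) *
        (\<Sum>m<n + k. X $$ (l, m) * u (int m - int j))) $$ (i, j) = (?U * (?X2 * ?U)) $$ (i, j)"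
      using ij by (simp add: inner[unfolded lessThan_atLeast0] scalar_prod_def lessThan_atLeast0)
  qed auto
  moreover have "Determinant.det (?U * (?X2 * ?U)) = Determinant.det ?U * (Determinant.det ?X2 * Determinant.det ?U)"
    using det_mult[of ?U k "?X2 * ?U"] det_mult[of ?X2 k ?U] mult_carrier_mat[of ?X2 k k ?U k] by simp
  ultimately show ?thesis
    using det_unit_upper_toeplitz[of u k] assms by simp
qed

section \<open>The determinant identity and both operator inverses\<close>

theorem theorem1p3:
  fixes \<beta> :: real and a log_a :: "complex \<Rightarrow> complex" and n \<kappa> :: nat
  assumes "\<beta> > 1/2" and "\<beta> \<notin> \<nat>"
    and "a \<in> holder_class \<beta>"
    and "\<forall>t\<in>sphere 0 1. a t \<noteq> 0"
    and "winding_number (a \<circ> circlepath 0 1) 0 = 0"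
    and "log_a \<in> holder_class \<beta>"
    and "\<forall>t\<in>sphere 0 1. exp (log_a t) = a t"
    and "n \<ge> 1" and "\<kappa> > 0"
    and "invertible_mat (toeplitz_mat (n + \<kappa>) a)"
  defines "b \<equiv> (\<lambda>t. wh_minus log_a t * inverse (wh_plus log_a t))"
    and "c \<equiv> (\<lambda>t. wh_plus log_a t * inverse (wh_minus log_a t))"
  defines "A \<equiv> id_minus (hankel_op b \<circ> hankel_op (tilde c) \<circ> proj_Q (n + \<kappa>))"
    and "B \<equiv> id_minus (hankel_op b \<circ> proj_Q n \<circ> hankel_op (tilde c) \<circ> proj_Q \<kappa>)"
  defines "F \<equiv> corner_det \<kappa>
      (toeplitz_op (\<lambda>t. t powi (- int n)) \<circ> inverse_op A \<circ> toeplitz_op b)"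
  shows "invertible_op A \<and> invertible_op B \<and>
    toeplitz_det n (\<lambda>t. t powi (- int \<kappa>) * a t)
      = (-1) ^ (n * \<kappa>) * toeplitz_det (n + \<kappa>) a * F \<and>
    F = corner_det \<kappa> (inverse_op B \<circ> toeplitz_op (\<lambda>t. t powi (- int n) * b t))"
proof -
  let ?N = "n + \<kappa>" and ?M = "toeplitz_mat (n + \<kappa>) a"
  let ?m = "wh_minus log_a" and ?p = "wh_plus log_a"
  have w: "wiener log_a"
    using assms(1,6) by (rule holder_class_wiener[rotated])
  note minus = wiener_wh_minus[OF w] and plus = wiener_wh_plus[OF w]
  have M: "?M \<in> carrier_mat ?N ?N"
    by (simp add: toeplitz_mat_def)
  obtain X where "inverts_mat ?M X" "inverts_mat X ?M"
    using assms(10) unfolding invertible_mat_def by blast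
  then have MX: "?M * X = 1\<^sub>m ?N" and XM: "X * ?M = 1\<^sub>m (dim_row X)"
    using M by (simp_all add: inverts_mat_def)
  \<comment> \<open>\<open>inverts_mat\<close> does not fix the size of \<open>X\<close>; it is
    recovered from the dimensions of the two product equations.\<close>
  have "dim_col X = ?N"
    using arg_cong[OF MX, of dim_col] by simp
  moreover have "dim_row X = ?N"
    using arg_cong[OF XM, of dim_col] M by simp
  ultimately have X: "X \<in> carrier_mat ?N ?N"
    by (intro carrier_matI)
  have XM': "X * ?M = 1\<^sub>m ?N"
    using XM by (simp only: \<open>dim_row X = ?N\<close>)
  have "fourier_coeff (\<lambda>t. ?m t * ?p t) = fourier_coeff a"
    using wh_factorization[OF w] assms(7) by (intro fourier_coeff_cong) auto
  then have mp: "toeplitz_mat ?N (\<lambda>t. ?m t * ?p t) = ?M"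
    by (simp add: toeplitz_mat_def)
  have nz: "?m t \<noteq> 0" "?p t \<noteq> 0" for t
    by (simp_all add: wh_plus_def wh_minus_def)
  interpret wh: wiener_hopf ?m ?p ?N X
    by unfold_locales (use minus plus X MX XM' nz in \<open>simp_all add: mp\<close>)
  have b_eq: "wh.b = b" and c_eq: "wh.c = c"
    by (simp_all add: fun_eq_iff wh.b_def wh.c_def b_def c_def)
  have A_eq: "wh.A = A"
    by (simp add: wh.A_def A_def b_eq c_eq)
  have invA: "invertible_op A"
    using wh.invertible_A by (simp only: A_eq)
  define U where "U x = hankel_op b (hankel_op (tilde c) (proj_Q ?N x))" for x
  have bb: "bounded_op (toeplitz_op b)"
    using bounded_op_toeplitz[OF wh.wiener_bc(1)] by (simp only: b_eq)
  have U: "bounded_op U"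
    unfolding U_def[abs_def] using wh.wiener_bc unfolding b_eq c_eq
    by (intro bounded_op_comp[OF bounded_op_hankel bounded_op_comp[OF bounded_op_hankel bounded_op_Q]] wiener_tilde)
  have A_U: "A = id_minus U"
    by (simp add: A_def U_def[abs_def] o_def)
  have QQ: "proj_Q ?N (proj_Q n x) = proj_Q ?N x" for x
    by (auto simp: proj_Q_apply)
  have UQ: "U (proj_Q n x) = U x" for x
    by (simp add: U_def QQ)
  \<comment> \<open>Both projections of \<open>B\<close> are absorbed: Q_n becomes a shift of the
    row index of the first Hankel factor, the second factor passes that shift on to its argument,
    and R Q_\<kappa> = Q_N R for the right shift R by \<open>n\<close>.\<close>
  have "hankel_op b (proj_Q n (hankel_op (tilde c) (proj_Q \<kappa> x))) j
      = U (\<lambda>k. if k < n then 0 else x (k - n)) (j + n)" for x j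
  proof -
    have "proj_Q ?N (\<lambda>k. if k < n then 0 else x (k - n)) = (\<lambda>k. if k < n then 0 else proj_Q \<kappa> x (k - n))"
      by (rule ext) (auto simp: proj_Q_apply)
    then show ?thesis
      by (simp only: U_def hankel_op_proj_Q hankel_op_shift_right)
  qed
  then have B_U: "B = id_minus (\<lambda>x j. U (\<lambda>k. if k < n then 0 else x (k - n)) (j + n))"
    unfolding B_def by (intro arg_cong[of _ _ id_minus] ext) simp
  have invB: "invertible_op B"
    unfolding B_U using shift_conjugate(1)[OF U UQ] invA unfolding A_U by simp
  have BL: "B (\<lambda>j. w (j + n)) = (\<lambda>j. A w (j + n))" if "w \<in> l2" for w
    unfolding B_U A_U using shift_conjugate(2)[OF U UQ] invA that unfolding A_U by simp
  let ?e = "\<lambda>k l. if l = k then 1 else 0 :: complex"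
  \<comment> \<open>Column \<open>k\<close> of A^{-1} T(b); the operator T(t^{-n}) discards its
    first \<open>n\<close> entries, so the matrix behind \<open>F\<close> starts in row
    \<open>n\<close>.\<close>
  define w where "w k = inverse_op A (toeplitz_op b (?e k))" for k
  have Tb: "toeplitz_op b (?e k) \<in> l2" for k
    by (rule bounded_op_l2[OF bb l2_unit])
  have wl: "w k \<in> l2" and Aw: "A (w k) = toeplitz_op b (?e k)" for k
    unfolding w_def using inverse_op_apply[OF invA Tb] by simp_all
  have F: "F = Determinant.det (Matrix.mat \<kappa> \<kappa> (\<lambda>(i, k). w k (i + n)))"
    by (simp add: F_def corner_det_def toeplitz_op_powi w_def)
  have "inverse_op B (toeplitz_op (\<lambda>t. t powi (- int n) * b t) (?e k)) = (\<lambda>j. w k (j + n))" for k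
  proof -
    \<comment> \<open>The left side is the left shift of T(b) applied to a unit vector, that is, of
      \<open>A (w k)\<close>; the intertwining relation \<open>BL\<close> moves the shift
      inside.\<close>
    have "toeplitz_op (\<lambda>t. t powi (- int n) * b t) (?e k) = B (\<lambda>j. w k (j + n))"
      by (simp only: toeplitz_op_powi_mult BL[OF wl] Aw)
    then show ?thesis
      using inverse_op_apply(3)[OF invB bounded_op_l2[OF bounded_op_shift_left wl]] by simp
  qed
  then have F': "F = corner_det \<kappa> (inverse_op B \<circ> toeplitz_op (\<lambda>t. t powi (- int n) * b t))"
    by (simp add: F corner_det_def)
  have entry: "w k (i + n) = (\<Sum>l<?N. fourier_coeff ?m (int (i + n) - int l) *
      (\<Sum>j<?N. X $$ (l, j) * fourier_coeff ?m (int j - int k)))" if "i < \<kappa>" for i k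
  proof -
    have "proj_P ?N (w k) = wh.Tm (finite_mat_op ?N X (wh.Tm (?e k)))"
      by (rule wh.solution_head[OF wl l2_unit]) (simp only: A_eq b_eq Aw)
    from fun_cong[OF this, of "i + n"] show ?thesis
      using that unfolding wh.Tm_def
      by (subst (asm) toeplitz_op_finite_support[where n = ?N])
        (auto simp: finite_mat_op_def proj_P_def toeplitz_op_unit)
  qed
  have "F = Determinant.det (Matrix.mat \<kappa> \<kappa> (\<lambda>(i, k). \<Sum>l<?N. fourier_coeff ?m (int (i + n) - int l) *
      (\<Sum>j<?N. X $$ (l, j) * fourier_coeff ?m (int j - int k))))"
    unfolding F by (rule arg_cong[of _ _ Determinant.det], rule eq_matI) (simp_all only: index_mat dim_row_mat dim_col_mat prod.case entry)
  also have "\<dots> = Determinant.det (Matrix.mat \<kappa> \<kappa> (\<lambda>(i, k). X $$ (n + i, k)))"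
    by (rule det_toeplitz_sandwich) (use minus in simp_all)
  finally have F_minor: "F = Determinant.det (Matrix.mat \<kappa> \<kappa> (\<lambda>(i, k). X $$ (n + i, k)))" .
  have "toeplitz_det ?N a * F
      = (-1) ^ (n * \<kappa>) * Determinant.det (Matrix.mat n n (\<lambda>(i, j). ?M $$ (\<kappa> + i, j)))"
    unfolding F_minor toeplitz_det_def by (rule jacobi_corner_minor[OF M X MX])
  \<comment> \<open>Starting in row \<kappa> raises every coefficient index by \<kappa>, which is
    the effect of multiplying the symbol by t^{-\<kappa>}.\<close>
  also have "Matrix.mat n n (\<lambda>(i, j). ?M $$ (\<kappa> + i, j)) = toeplitz_mat n (\<lambda>t. t powi (- int \<kappa>) * a t)"
    by (rule eq_matI)
      (auto simp: toeplitz_mat_def fourier_coeff_powi_mult intro!: arg_cong[of _ _ "fourier_coeff a"])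
  finally have "(-1) ^ (n * \<kappa>) * (toeplitz_det ?N a * F)
      = ((-1) ^ (n * \<kappa>) * (-1) ^ (n * \<kappa>)) * toeplitz_det n (\<lambda>t. t powi (- int \<kappa>) * a t)"
    by (simp only: toeplitz_det_def mult.assoc)
  also have "(-1) ^ (n * \<kappa>) * (-1) ^ (n * \<kappa>) = (1 :: complex)"
    by (simp flip: power_mult_distrib)
  finally have det: "toeplitz_det n (\<lambda>t. t powi (- int \<kappa>) * a t) = (-1) ^ (n * \<kappa>) * toeplitz_det ?N a * F"
    by (simp only: mult_1_left mult.assoc)
  show ?thesis
    by (intro conjI invA invB det F')
qed

end
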